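(* Let $(E,\mathcal{B},m)$ be a $\sigma$-finite measure space. Let $D_0$ be a dense linear subspace of $L^2(m)$ and let $L_0\colon D_0\to L^2(m)$ be a symmetric linear operator which is upper bounded, i.e. $\sup_{u\in D_0\setminus\{0\}}(L_0u,u)_2\,\|u\|_2^{-2}<\infty$. Consider, for paths $(\mu_t)_{t\ge0}\in\mathcal{SP}$ with each $\mu_t$ absolutely continuous with respect to $m$, the equations $$\text{(a)}\quad \int\varphi\,d\mu_t=\int\varphi\,d\mu_0+\int_0^t\int L_0\varphi\,d\mu_s\,ds\qquad\text{for all } t\ge0,\ \varphi\in D_0,$$ $$\text{(b)}\quad \int_0^T\int\big(f'(s)\varphi+f(s)L_0\varphi\big)\,d\mu_s\,ds=-f(0)\int\varphi\,d\mu_0\qquad\text{for all } T\in(0,\infty),\ \varphi\in D_0,\ f\in C^1([0,T];\mathbb{R})\text{ with }f(T)=0.$$ Suppose that, for every $u\in L^1(m)\cap L^\infty(m)$ with $u\ge0$ and $\int u\,dm=1$, equation (a) (or, alternatively, for every such $u$, equation (b)) has a unique solution $(\mu_t)_{t\ge0}\in\mathcal{SP}$ such that each $\mu_t$, $t\ge0$, is absolutely continuous with respect to $m$ and $\mu_0=u\cdot m$. Then $\mathcal{M}_{sym,M}(L_0,D_0)$ consists of at most one element. If, in addition, the semigroup generated by the Friedrichs extension of $(L_0,D_0)$ is sub-Markovian, then this extension is the unique element of $\mathcal{M}_{sym,M}(L_0,D_0)$.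
   Context: All $L^p$-spaces are real; $(\cdot,\cdot)_2$ and $\|\cdot\|_2$ are the inner product and norm of $L^2(m)$. $\mathcal{SP}$ is the set of all paths $(\mu_t)_{t\ge0}$ of subprobability measures on $(E,\mathcal{B})$ (nonnegative measures with $\mu_t(E)\le1$) such that $[0,\infty)\ni t\mapsto\mu_t(A)$ is Lebesgue measurable for every $A\in\mathcal{B}$. Being a solution of (a) or (b) includes that the integrals appearing in the equation exist. For (b), which only involves $\mu_0$ and $\mu_t$ for $dt$-a.e. $t$, two solutions are identified if they coincide for $dt$-a.e. $t$. A linear operator $L\colon D(L)\subset L^2(m)\to L^2(m)$ is called a generator on $L^2(m)$ if it is the generator of a strongly continuous semigroup $(e^{tL})_{t\ge0}$ of everywhere defined continuous linear operators on $L^2(m)$. $L_1\subset L_2$ means that the graph of $L_1$ is contained in the graph of $L_2$; $L$ is symmetric if $L\subset L^*$. The semigroup $(e^{tL})_{t\ge0}$ is sub-Markovian if for every $t\ge0$ and every $u\in L^2(m)$ with $0\le u\le1$ one has $0\le e^{tL}u\le1$ ($m$-a.e.). $\mathcal{M}_{sym,M}(L_0,D_0)$ is the set of all linear operators $L\colon D(L)\subset L^2(m)\to L^2(m)$ such that $L_0\subset L$, $L$ is a generator on $L^2(m)$, $L$ is symmetric, and $(e^{tL})_{t\ge0}$ is sub-Markovian. The Friedrichs extension of $(L_0,D_0)$ is the upper bounded self-adjoint extension associated with the closure of the upper bounded quadratic form $(u,v)\mapsto(L_0u,v)_2$ on $D_0$. *)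

theory Defs
  imports "HOL-Analysis.Analysis"
begin

text \<open>
  Elements of L2 are represented by functions; two functions represent the same
  element iff they agree almost everywhere.  Subsets of L2 and graphs of operators
  are therefore sets of representatives that are closed under a.e. equality, so
  that equality and inclusion of such sets are equality and inclusion of the
  corresponding sets of classes.
\<close>

definition L2 :: "'a measure \<Rightarrow> ('a \<Rightarrow> real) set" where
  "L2 m = {u \<in> borel_measurable m. integrable m (\<lambda>x. (u x)\<^sup>2)}"

definition l2_inner :: "'a measure \<Rightarrow> ('a \<Rightarrow> real) \<Rightarrow> ('a \<Rightarrow> real) \<Rightarrow> real" where
  "l2_inner m u v = (\<integral>x. u x * v x \<partial>m)"

definition l2_norm :: "'a measure \<Rightarrow> ('a \<Rightarrow> real) \<Rightarrow> real" where
  "l2_norm m u = sqrt (l2_inner m u u)"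

definition l2_dense :: "'a measure \<Rightarrow> ('a \<Rightarrow> real) set \<Rightarrow> bool" where
  "l2_dense m D \<longleftrightarrow>
     D \<subseteq> L2 m \<and> (\<forall>u\<in>L2 m. \<forall>\<epsilon>>0. \<exists>v\<in>D. l2_norm m (\<lambda>x. u x - v x) < \<epsilon>)"

type_synonym 'a l2_graph = "(('a \<Rightarrow> real) \<times> ('a \<Rightarrow> real)) set"

text \<open>
  The pair \<open>(u, v)\<close> belongs to the graph iff the class of u lies in the domain and is
  mapped to the class of v.  The domain of the operator is \<open>Domain G\<close>.
\<close>

definition l2_operator :: "'a measure \<Rightarrow> 'a l2_graph \<Rightarrow> bool" where
  "l2_operator m G \<longleftrightarrow>
     G \<subseteq> L2 m \<times> L2 m \<and>
     (\<forall>(u, v)\<in>G. \<forall>u'\<in>borel_measurable m. \<forall>v'\<in>borel_measurable m.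
        (AE x in m. u' x = u x) \<longrightarrow> (AE x in m. v' x = v x) \<longrightarrow> (u', v') \<in> G) \<and>
     (\<forall>u v v'. (u, v) \<in> G \<longrightarrow> (u, v') \<in> G \<longrightarrow> (AE x in m. v x = v' x)) \<and>
     ((\<lambda>_. 0), (\<lambda>_. 0)) \<in> G \<and>
     (\<forall>(u, v)\<in>G. \<forall>(u', v')\<in>G. ((\<lambda>x. u x + u' x), (\<lambda>x. v x + v' x)) \<in> G) \<and>
     (\<forall>c::real. \<forall>(u, v)\<in>G. ((\<lambda>x. c * u x), (\<lambda>x. c * v x)) \<in> G)"

definition l2_adjoint :: "'a measure \<Rightarrow> 'a l2_graph \<Rightarrow> 'a l2_graph" where
  "l2_adjoint m G =
     {(v, w). v \<in> L2 m \<and> w \<in> L2 m \<and> (\<forall>(u, u')\<in>G. l2_inner m u' v = l2_inner m u w)}"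

definition l2_symmetric :: "'a measure \<Rightarrow> 'a l2_graph \<Rightarrow> bool" where
  "l2_symmetric m G \<longleftrightarrow> G \<subseteq> l2_adjoint m G"

definition upper_bounded :: "'a measure \<Rightarrow> 'a l2_graph \<Rightarrow> bool" where
  "upper_bounded m G \<longleftrightarrow>
     bdd_above {l2_inner m v u / (l2_norm m u)\<^sup>2 | u v. (u, v) \<in> G \<and> l2_norm m u \<noteq> 0}"

text \<open>
  Compatibility with a.e. equality is a consequence of linearity and boundedness.
\<close>

definition l2_bounded_linear :: "'a measure \<Rightarrow> (('a \<Rightarrow> real) \<Rightarrow> ('a \<Rightarrow> real)) \<Rightarrow> bool" where
  "l2_bounded_linear m S \<longleftrightarrow>
     S ` L2 m \<subseteq> L2 m \<and>
     (\<forall>u\<in>L2 m. \<forall>v\<in>L2 m. AE x in m. S (\<lambda>y. u y + v y) x = S u x + S v x) \<and>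
     (\<forall>c::real. \<forall>u\<in>L2 m. AE x in m. S (\<lambda>y. c * u y) x = c * S u x) \<and>
     (\<exists>C. \<forall>u\<in>L2 m. l2_norm m (S u) \<le> C * l2_norm m u)"

definition strongly_continuous_semigroup ::
    "'a measure \<Rightarrow> (real \<Rightarrow> ('a \<Rightarrow> real) \<Rightarrow> ('a \<Rightarrow> real)) \<Rightarrow> bool" where
  "strongly_continuous_semigroup m S \<longleftrightarrow>
     (\<forall>t\<ge>0. l2_bounded_linear m (S t)) \<and>
     (\<forall>u\<in>L2 m. AE x in m. S 0 u x = u x) \<and>
     (\<forall>s\<ge>0. \<forall>t\<ge>0. \<forall>u\<in>L2 m. AE x in m. S (s + t) u x = S s (S t u) x) \<and>
     (\<forall>u\<in>L2 m. \<forall>t\<ge>0.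
        ((\<lambda>s. l2_norm m (\<lambda>x. S s u x - S t u x)) \<longlongrightarrow> 0) (at t within {0..}))"

definition semigroup_generator ::
    "'a measure \<Rightarrow> (real \<Rightarrow> ('a \<Rightarrow> real) \<Rightarrow> ('a \<Rightarrow> real)) \<Rightarrow> 'a l2_graph" where
  "semigroup_generator m S =
     {(u, v). u \<in> L2 m \<and> v \<in> L2 m \<and>
        ((\<lambda>t. l2_norm m (\<lambda>x. (S t u x - u x) / t - v x)) \<longlongrightarrow> 0) (at_right 0)}"

definition generates ::
    "'a measure \<Rightarrow> 'a l2_graph \<Rightarrow> (real \<Rightarrow> ('a \<Rightarrow> real) \<Rightarrow> ('a \<Rightarrow> real)) \<Rightarrow> bool" where
  "generates m G S \<longleftrightarrow> strongly_continuous_semigroup m S \<and> G = semigroup_generator m S"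

definition is_generator :: "'a measure \<Rightarrow> 'a l2_graph \<Rightarrow> bool" where
  "is_generator m G \<longleftrightarrow> (\<exists>S. generates m G S)"

definition sub_Markovian ::
    "'a measure \<Rightarrow> (real \<Rightarrow> ('a \<Rightarrow> real) \<Rightarrow> ('a \<Rightarrow> real)) \<Rightarrow> bool" where
  "sub_Markovian m S \<longleftrightarrow>
     (\<forall>t\<ge>0. \<forall>u\<in>L2 m. (AE x in m. 0 \<le> u x \<and> u x \<le> 1) \<longrightarrow>
        (AE x in m. 0 \<le> S t u x \<and> S t u x \<le> 1))"

text \<open>
  A generator determines its semigroup up to a.e. equality, so the existential
  quantifier below speaks about the semigroup generated by G.
\<close>

definition generates_sub_Markovian :: "'a measure \<Rightarrow> 'a l2_graph \<Rightarrow> bool" where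
  "generates_sub_Markovian m G \<longleftrightarrow> (\<exists>S. generates m G S \<and> sub_Markovian m S)"

definition M_sym_M :: "'a measure \<Rightarrow> 'a l2_graph \<Rightarrow> 'a l2_graph set" where
  "M_sym_M m L0 =
     {L. l2_operator m L \<and> L0 \<subseteq> L \<and> is_generator m L \<and> l2_symmetric m L \<and>
         generates_sub_Markovian m L}"

definition form_of :: "'a measure \<Rightarrow> 'a l2_graph \<Rightarrow> ('a \<Rightarrow> real) \<Rightarrow> ('a \<Rightarrow> real) \<Rightarrow> real" where
  "form_of m G u v = l2_inner m (SOME w. (u, w) \<in> G) v"

text \<open>
  For an upper bounded form Q, with \<open>Q(u, u) \<le> C \<parallel>u\<parallel>\<^sup>2\<close>, a sequence is Cauchy for the form norm
  \<open>(1 + C) \<parallel>u\<parallel>\<^sup>2 - Q(u, u)\<close> (squared) iff it is Cauchy in L2 and the values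
  \<open>Q(U i - U j, U i - U j)\<close> tend to 0.
\<close>

definition form_approx :: "'a measure \<Rightarrow> ('a \<Rightarrow> real) set \<Rightarrow> (('a \<Rightarrow> real) \<Rightarrow> ('a \<Rightarrow> real) \<Rightarrow> real) \<Rightarrow>
    (nat \<Rightarrow> ('a \<Rightarrow> real)) \<Rightarrow> ('a \<Rightarrow> real) \<Rightarrow> bool" where
  "form_approx m D Q U u \<longleftrightarrow>
     u \<in> L2 m \<and> range U \<subseteq> D \<and>
     (\<lambda>n. l2_norm m (\<lambda>x. U n x - u x)) \<longlonglongrightarrow> 0 \<and>
     (\<forall>\<epsilon>>0. \<exists>N. \<forall>i\<ge>N. \<forall>j\<ge>N. \<bar>Q (\<lambda>x. U i x - U j x) (\<lambda>x. U i x - U j x)\<bar> < \<epsilon>)"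

definition form_closure_domain ::
    "'a measure \<Rightarrow> ('a \<Rightarrow> real) set \<Rightarrow> (('a \<Rightarrow> real) \<Rightarrow> ('a \<Rightarrow> real) \<Rightarrow> real) \<Rightarrow> ('a \<Rightarrow> real) set" where
  "form_closure_domain m D Q = {u. \<exists>U. form_approx m D Q U u}"

definition form_closure :: "'a measure \<Rightarrow> ('a \<Rightarrow> real) set \<Rightarrow>
    (('a \<Rightarrow> real) \<Rightarrow> ('a \<Rightarrow> real) \<Rightarrow> real) \<Rightarrow> ('a \<Rightarrow> real) \<Rightarrow> ('a \<Rightarrow> real) \<Rightarrow> real" where
  "form_closure m D Q u v =
     (THE c. \<forall>U V. form_approx m D Q U u \<longrightarrow> form_approx m D Q V v \<longrightarrow>
        (\<lambda>n. Q (U n) (V n)) \<longlonglongrightarrow> c)"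

definition form_operator ::
    "'a measure \<Rightarrow> ('a \<Rightarrow> real) set \<Rightarrow> (('a \<Rightarrow> real) \<Rightarrow> ('a \<Rightarrow> real) \<Rightarrow> real) \<Rightarrow> 'a l2_graph" where
  "form_operator m D Q =
     {(u, w). u \<in> D \<and> w \<in> L2 m \<and> (\<forall>v\<in>D. Q u v = l2_inner m w v)}"

definition friedrichs_extension :: "'a measure \<Rightarrow> 'a l2_graph \<Rightarrow> 'a l2_graph" where
  "friedrichs_extension m G =
     form_operator m (form_closure_domain m (Domain G) (form_of m G))
                     (form_closure m (Domain G) (form_of m G))"

text \<open>Only the values of a path at nonnegative times are relevant.\<close>

definition SP :: "'a measure \<Rightarrow> (real \<Rightarrow> 'a measure) set" where
  "SP m = {\<mu>. (\<forall>t\<ge>0. sets (\<mu> t) = sets m \<and> emeasure (\<mu> t) (space m) \<le> 1) \<and>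
             (\<forall>A\<in>sets m. (\<lambda>t. measure (\<mu> t) A) \<in> borel_measurable (lebesgue_on {0..}))}"

text \<open>
  The inner integrals under a time integral are required to exist for almost every
  time; the time integrals are Lebesgue integrals.
\<close>

definition equation_a :: "'a l2_graph \<Rightarrow> (real \<Rightarrow> 'a measure) \<Rightarrow> bool" where
  "equation_a L0 \<mu> \<longleftrightarrow>
     (\<forall>t\<ge>0. \<forall>(\<phi>, \<psi>)\<in>L0.
        integrable (\<mu> t) \<phi> \<and> integrable (\<mu> 0) \<phi> \<and>
        (AE s in lebesgue_on {0..t}. integrable (\<mu> s) \<psi>) \<and>
        integrable (lebesgue_on {0..t}) (\<lambda>s. \<integral>x. \<psi> x \<partial>\<mu> s) \<and>
        (\<integral>x. \<phi> x \<partial>\<mu> t) =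
          (\<integral>x. \<phi> x \<partial>\<mu> 0) + (\<integral>s. (\<integral>x. \<psi> x \<partial>\<mu> s) \<partial>lebesgue_on {0..t}))"

definition equation_b :: "'a l2_graph \<Rightarrow> (real \<Rightarrow> 'a measure) \<Rightarrow> bool" where
  "equation_b L0 \<mu> \<longleftrightarrow>
     (\<forall>T>0. \<forall>(\<phi>, \<psi>)\<in>L0. \<forall>f f' :: real \<Rightarrow> real.
        (\<forall>s\<in>{0..T}. (f has_real_derivative f' s) (at s within {0..T})) \<longrightarrow>
        continuous_on {0..T} f' \<longrightarrow> f T = 0 \<longrightarrow>
        integrable (\<mu> 0) \<phi> \<and>
        (AE s in lebesgue_on {0..T}. integrable (\<mu> s) (\<lambda>x. f' s * \<phi> x + f s * \<psi> x)) \<and>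
        integrable (lebesgue_on {0..T}) (\<lambda>s. \<integral>x. f' s * \<phi> x + f s * \<psi> x \<partial>\<mu> s) \<and>
        (\<integral>s. (\<integral>x. f' s * \<phi> x + f s * \<psi> x \<partial>\<mu> s) \<partial>lebesgue_on {0..T})
          = - f 0 * (\<integral>x. \<phi> x \<partial>\<mu> 0))"

definition ac_path_from :: "'a measure \<Rightarrow> ('a \<Rightarrow> real) \<Rightarrow> (real \<Rightarrow> 'a measure) \<Rightarrow> bool" where
  "ac_path_from m u \<mu> \<longleftrightarrow>
     \<mu> \<in> SP m \<and> (\<forall>t\<ge>0. absolutely_continuous m (\<mu> t)) \<and>
     \<mu> 0 = density m (\<lambda>x. ennreal (u x))"

definition uniquely_solvable_a :: "'a measure \<Rightarrow> 'a l2_graph \<Rightarrow> ('a \<Rightarrow> real) \<Rightarrow> bool" where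
  "uniquely_solvable_a m L0 u \<longleftrightarrow>
     (\<exists>\<mu>. ac_path_from m u \<mu> \<and> equation_a L0 \<mu> \<and>
        (\<forall>\<nu>. ac_path_from m u \<nu> \<longrightarrow> equation_a L0 \<nu> \<longrightarrow> (\<forall>t\<ge>0. \<nu> t = \<mu> t)))"

definition uniquely_solvable_b :: "'a measure \<Rightarrow> 'a l2_graph \<Rightarrow> ('a \<Rightarrow> real) \<Rightarrow> bool" where
  "uniquely_solvable_b m L0 u \<longleftrightarrow>
     (\<exists>\<mu>. ac_path_from m u \<mu> \<and> equation_b L0 \<mu> \<and>
        (\<forall>\<nu>. ac_path_from m u \<nu> \<longrightarrow> equation_b L0 \<nu> \<longrightarrow>
           (AE t in lebesgue_on {0..}. \<nu> t = \<mu> t)))"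

definition bounded_densities :: "'a measure \<Rightarrow> ('a \<Rightarrow> real) set" where
  "bounded_densities m =
     {u. integrable m u \<and> (\<exists>C. AE x in m. \<bar>u x\<bar> \<le> C) \<and> (AE x in m. 0 \<le> u x) \<and>
         (\<integral>x. u x \<partial>m) = 1}"

end

theory Submission imports Defs
begin

text \<open>
  If L is a symmetric generator with semigroup S, then \<open>s \<mapsto> (S s u, S (t - s) w)\<close> is constant on
  \<open>[0, t]\<close> for u and w in the domain, so every \<open>S t\<close> is symmetric.  For a bounded probability
  density u, symmetry and the sub-Markov property give that the measures \<open>S t u \<cdot> m\<close> have mass at
  most 1, and \<open>\<integral>\<phi> S t u dm = (u, S t \<phi>)\<close> has derivative \<open>(u, S t (L0 \<phi>))\<close>, so
  these measures solve both equations.  Hence two semigroups whose generators belong to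
  \<open>M_sym_M m L0\<close> agree on bounded densities, and by symmetry, tested with normalized indicators,
  they agree on all of L2.  For the second claim the generator property of the Friedrichs
  extension is part of the hypothesis that it generates a sub-Markovian semigroup; it remains
  to see that it is a symmetric operator extending L0, which rests on the closability of the form.
\<close>

text \<open>The generator is a limit as t tends to 0 from the right, so norm estimates for orbits
  directly give only right derivatives. The direct estimate of left difference quotients would call
  for bounds on \<open>S t\<close> that are uniform for t in bounded intervals, whereas
  \<open>l2_bounded_linear\<close> gives one constant for each t. Orbits are therefore paired with
  fixed vectors, and real analysis does the rest: a continuous function with a continuous right
  derivative is differentiable. The symmetry of \<open>S t\<close> depends on this, since there one
  factor, \<open>S (t - s) w\<close>, runs backward in time. A second obstacle is that the constant
  1 need not be square integrable. Mass and measurability in time are therefore first treated on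
  sets of finite measure, whose indicators lie in L2, and then extended by exhaustion. Finally, the
  form of an operator that is only bounded above has no sign. Shifting it by \<open>C + 1\<close>
  gives a semi-inner product \<open>P\<close> that dominates the L2 inner product, and the estimates
  for the closure are made with \<open>P\<close>.\<close>

section \<open>Functions with a right derivative\<close>

text \<open>The mean value theorem needs two-sided derivatives. Instead, take the last point
  \<open>s\<close> at which \<open>f\<close> is not above the line of slope \<open>e\<close> through
  its starting point: if \<open>s < b\<close>, then \<open>g\<close> has right derivative
  \<open>- e\<close> at \<open>s\<close>, so a later point would also qualify.\<close>

lemma le_of_zero_right_derivative:
  fixes f :: "real \<Rightarrow> real"
  assumes ab: "a \<le> b" and cont: "continuous_on {a..b} f" and e: "e > 0"
    and der: "\<And>t. a \<le> t \<Longrightarrow> t < b \<Longrightarrow> (f has_real_derivative 0) (at_right t)"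
  shows "f b - f a \<le> e * (b - a)"
proof (rule ccontr)
  assume neg: "\<not> ?thesis"
  define g where "g t = f t - f a - e * (t - a)" for t
  have contg: "continuous_on {a..b} g"
    unfolding g_def by (intro continuous_intros cont)
  define K where "K = {t \<in> {a..b}. g t \<le> 0}"
  have "K = {a..b} \<inter> g -` {..0}" by (auto simp: K_def)
  then have "closed K"
    using continuous_closed_preimage[OF contg closed_atLeastAtMost closed_atMost] by simp
  moreover have "bounded K"
    by (rule bounded_subset[OF bounded_closed_interval[of a b]]) (auto simp: K_def)
  ultimately have "compact K" by (simp add: compact_eq_bounded_closed)
  moreover have "a \<in> K" using ab by (simp add: K_def g_def)
  ultimately obtain s where s: "s \<in> K" and max: "\<And>t. t \<in> K \<Longrightarrow> t \<le> s"
    using compact_attains_sup[of K] by blast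
  have "g b > 0" using neg by (simp add: g_def)
  with s have sb: "a \<le> s" "s < b" and gs: "g s \<le> 0"
    by (auto simp: K_def less_le)
  have "(g has_real_derivative (0 - e)) (at_right s)"
    unfolding g_def by (auto intro!: derivative_eq_intros der sb)
  then have "((\<lambda>t. (g t - g s) / (t - s)) \<longlongrightarrow> 0 - e) (at_right s)"
    by (simp add: has_field_derivative_iff)
  then have "\<forall>\<^sub>F t in at_right s. (g t - g s) / (t - s) < 0"
    using e by (intro order_tendstoD(2)) auto
  moreover have "\<forall>\<^sub>F t in at_right s. t < b"
    using sb by (auto simp: eventually_at_right)
  moreover have "\<forall>\<^sub>F t in at_right s. t > s"
    by (simp add: eventually_at_right_less)
  ultimately have "\<forall>\<^sub>F t in at_right s. s < t \<and> t < b \<and> (g t - g s) / (t - s) < 0"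
    by eventually_elim auto
  then obtain t where t: "s < t" "t < b" "(g t - g s) / (t - s) < 0"
    using eventually_happens'[OF trivial_limit_at_right_real] by blast
  then have "g t \<le> 0" using gs by (simp add: divide_less_0_iff)
  then have "t \<in> K" using t sb by (simp add: K_def)
  then show False using max[of t] t by simp
qed

lemma constant_of_zero_right_derivative:
  fixes f :: "real \<Rightarrow> real"
  assumes ab: "a \<le> b" and cont: "continuous_on {a..b} f"
    and der: "\<And>t. a \<le> t \<Longrightarrow> t < b \<Longrightarrow> (f has_real_derivative 0) (at_right t)"
  shows "f b = f a"
proof -
  have le: "g b - g a \<le> 0" if "continuous_on {a..b} g"
      "\<And>t. a \<le> t \<Longrightarrow> t < b \<Longrightarrow> (g has_real_derivative 0) (at_right t)" for g :: "real \<Rightarrow> real"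
  proof (rule field_le_epsilon)
    fix e :: real assume e: "e > 0"
    \<comment> \<open>The summand 1 keeps the denominator positive when
      \<open>a = b\<close>.\<close>
    have "e / (b - a + 1) > 0" using e ab by simp
    from le_of_zero_right_derivative[OF ab that(1) this that(2)]
    have "g b - g a \<le> e / (b - a + 1) * (b - a)" .
    also have "\<dots> \<le> e" using e ab by (simp add: field_simps)
    finally show "g b - g a \<le> 0 + e" by simp
  qed
  have "((\<lambda>t. - f t) has_real_derivative 0) (at_right t)" if "a \<le> t" "t < b" for t
    using DERIV_minus[OF der[OF that]] by simp
  with le[of "\<lambda>t. - f t"] le[OF cont der] continuous_on_minus[OF cont] show ?thesis
    by simp
qed

text \<open>Subtracting the antiderivative \<open>G\<close> of \<open>h\<close> leaves a function
  with right derivative 0, hence a constant; \<open>G\<close> itself is differentiable from both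
  sides because \<open>h\<close> is continuous.\<close>

lemma has_derivative_of_continuous_right_derivative:
  fixes g h :: "real \<Rightarrow> real"
  assumes contg: "continuous_on {0..} g" and conth: "continuous_on {0..} h"
    and der: "\<And>t. t \<ge> 0 \<Longrightarrow> (g has_real_derivative h t) (at_right t)"
    and t: "t \<ge> 0"
  shows "(g has_real_derivative h t) (at t within {0..})"
proof -
  define G where "G s = integral {0..s} h" for s
  have conth': "continuous_on {0..T} h" for T
    by (rule continuous_on_subset[OF conth]) auto
  have derG: "(G has_real_derivative h s) (at s within {0..})" if "s \<ge> 0" for s
  proof -
    have "(G has_real_derivative h s) (at s within {0..s+1})"
      unfolding G_def using that by (intro integral_has_real_derivative conth') auto
    moreover have "at s within {0..s+1} = at s within {0..}"
      by (rule at_within_nhd[of _ "{..<s+1}"]) auto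
    ultimately show ?thesis by simp
  qed
  have contG: "continuous_on {0..} G"
    using derG by (auto simp: continuous_on_eq_continuous_within intro: DERIV_continuous)
  have eq: "g s = G s + g 0" if "s \<ge> 0" for s
  proof -
    have "g s - G s = g 0 - G 0"
    proof (rule constant_of_zero_right_derivative[where f = "\<lambda>s. g s - G s", OF that])
      show "continuous_on {0..s} (\<lambda>s. g s - G s)"
        by (intro continuous_on_diff continuous_on_subset[OF contg] continuous_on_subset[OF contG])
           auto
      fix r :: real assume r: "0 \<le> r"
      have "(G has_real_derivative h r) (at_right r)"
        by (rule has_field_derivative_subset[OF derG[OF r]]) (use r in auto)
      from DERIV_diff[OF der[OF r] this]
      show "((\<lambda>s. g s - G s) has_real_derivative 0) (at_right r)" by simp
    qed
    then show ?thesis by (simp add: G_def)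
  qed
  have "((\<lambda>s. G s + g 0) has_real_derivative h t) (at t within {0..})"
    by (auto intro!: derivative_eq_intros derG t)
  then show ?thesis
    by (rule has_field_derivative_transform_within[where d = 1]) (use t eq[symmetric] in auto)
qed

lemma has_real_derivative_at_right_iff:
  fixes f :: "real \<Rightarrow> real"
  shows "(f has_real_derivative D) (at_right t) \<longleftrightarrow>
    ((\<lambda>h. (f (t + h) - f t) / h) \<longlongrightarrow> D) (at_right 0)"
proof -
  have "(f has_real_derivative D) (at_right t) \<longleftrightarrow>
      ((\<lambda>y. (f y - f t) / (y - t)) \<longlongrightarrow> D) (at_right t)"
    by (rule has_field_derivative_iff)
  then show ?thesis
    by (simp add: at_right_to_0[of t] filterlim_filtermap add.commute)
qed

section \<open>Semi-inner products on spaces of functions\<close>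

text \<open>Definiteness is not assumed: functions that agree almost everywhere are distinct but
  have distance 0. The locale is instantiated with L2 and with the shifted form \<open>P\<close> on
  the domain of the operator.\<close>

locale semi_inner =
  fixes V :: "('a \<Rightarrow> real) set" and B :: "('a \<Rightarrow> real) \<Rightarrow> ('a \<Rightarrow> real) \<Rightarrow> real"
  assumes add_mem: "u \<in> V \<Longrightarrow> v \<in> V \<Longrightarrow> (\<lambda>x. u x + v x) \<in> V"
    and scale_mem: "u \<in> V \<Longrightarrow> (\<lambda>x. c * u x) \<in> V"
    and add_left: "u \<in> V \<Longrightarrow> v \<in> V \<Longrightarrow> w \<in> V \<Longrightarrow> B (\<lambda>x. u x + v x) w = B u w + B v w"
    and scale_left: "u \<in> V \<Longrightarrow> w \<in> V \<Longrightarrow> B (\<lambda>x. c * u x) w = c * B u w"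
    and commute: "u \<in> V \<Longrightarrow> w \<in> V \<Longrightarrow> B u w = B w u"
    and nonneg: "u \<in> V \<Longrightarrow> 0 \<le> B u u"
begin

lemma minus_mem: "u \<in> V \<Longrightarrow> (\<lambda>x. - u x) \<in> V"
  using scale_mem[of u "-1"] by simp

lemma diff_mem: "u \<in> V \<Longrightarrow> v \<in> V \<Longrightarrow> (\<lambda>x. u x - v x) \<in> V"
  using add_mem[of u "\<lambda>x. - v x"] minus_mem[of v] by simp

lemma divide_mem: "u \<in> V \<Longrightarrow> (\<lambda>x. u x / c) \<in> V"
  using scale_mem[of u "inverse c"] by (simp add: field_simps)

lemma minus_left: "u \<in> V \<Longrightarrow> w \<in> V \<Longrightarrow> B (\<lambda>x. - u x) w = - B u w"
  using scale_left[of u w "-1"] by simp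

lemma diff_left:
  assumes "u \<in> V" "v \<in> V" "w \<in> V"
  shows "B (\<lambda>x. u x - v x) w = B u w - B v w"
  using add_left[OF assms(1) minus_mem[OF assms(2)] assms(3)] minus_left[OF assms(2,3)] by simp

lemma divide_left: "u \<in> V \<Longrightarrow> w \<in> V \<Longrightarrow> B (\<lambda>x. u x / c) w = B u w / c"
  using scale_left[of u w "inverse c"] by (simp add: field_simps)

lemma add_right:
  assumes "u \<in> V" "v \<in> V" "w \<in> V"
  shows "B w (\<lambda>x. u x + v x) = B w u + B w v"
  unfolding commute[OF assms(3) add_mem[OF assms(1,2)]] add_left[OF assms]
  using commute[OF assms(3,1)] commute[OF assms(3,2)] by simp

lemma scale_right:
  assumes "u \<in> V" "w \<in> V"
  shows "B w (\<lambda>x. c * u x) = c * B w u"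
  unfolding commute[OF assms(2) scale_mem[OF assms(1)]] scale_left[OF assms]
  by (simp add: commute[OF assms(2,1)])

lemma diff_right:
  assumes "u \<in> V" "v \<in> V" "w \<in> V"
  shows "B w (\<lambda>x. u x - v x) = B w u - B w v"
  unfolding commute[OF assms(3) diff_mem[OF assms(1,2)]] diff_left[OF assms]
  using commute[OF assms(3,1)] commute[OF assms(3,2)] by simp

definition N :: "('a \<Rightarrow> real) \<Rightarrow> real" where "N u = sqrt (B u u)"

lemma N_nonneg [simp]: "u \<in> V \<Longrightarrow> 0 \<le> N u" by (simp add: N_def nonneg)

lemma N_square: "u \<in> V \<Longrightarrow> (N u)\<^sup>2 = B u u" by (simp add: N_def nonneg)

lemma Cauchy_Schwarz:
  assumes u: "u \<in> V" and v: "v \<in> V"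
  shows "\<bar>B u v\<bar> \<le> N u * N v"
proof -
  have quad: "0 \<le> B u u + 2 * t * B u v + t\<^sup>2 * B v v" for t
  proof -
    have "0 \<le> B (\<lambda>x. u x + t * v x) (\<lambda>x. u x + t * v x)"
      by (intro nonneg add_mem scale_mem u v)
    also have "\<dots> = B u u + 2 * t * B u v + t\<^sup>2 * B v v"
      using u v by (simp add: add_left add_right scale_left scale_right add_mem scale_mem
          commute[of v u] power2_eq_square algebra_simps)
    finally show ?thesis .
  qed
  have "(B u v)\<^sup>2 \<le> B u u * B v v"
  \<comment> \<open>In the degenerate case the quadratic is affine in \<open>t\<close> and would
    take the value -1 if \<open>B u v\<close> were nonzero. Otherwise it is evaluated at its
    minimizer \<open>- B u v / B v v\<close>.\<close>
  proof (cases "B v v = 0")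
    case True
    have "B u v = 0"
    proof (rule ccontr)
      assume nz: "B u v \<noteq> 0"
      have "0 \<le> B u u + 2 * (- (B u u + 1) / (2 * B u v)) * B u v"
        using quad[of "- (B u u + 1) / (2 * B u v)"] True by simp
      also have "\<dots> = -1" using nz by (simp add: field_simps)
      finally show False by simp
    qed
    then show ?thesis by (simp add: True)
  next
    case False
    then have pos: "B v v > 0" using nonneg[OF v] by simp
    have "B u u + 2 * (- B u v / B v v) * B u v + (- B u v / B v v)\<^sup>2 * B v v
        = B u u - (B u v)\<^sup>2 / B v v"
      using pos by (simp add: field_simps power2_eq_square)
    with quad[of "- B u v / B v v"] have "(B u v)\<^sup>2 / B v v \<le> B u u" by simp
    then show ?thesis using pos by (simp add: field_simps)
  qed
  also have "\<dots> = (N u * N v)\<^sup>2"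
    by (simp add: power_mult_distrib N_square u v)
  finally show ?thesis
    by (rule power2_le_imp_le[of "\<bar>B u v\<bar>", simplified power2_abs]) (use u v in simp)
qed

lemma triangle:
  assumes u: "u \<in> V" and v: "v \<in> V"
  shows "N (\<lambda>x. u x + v x) \<le> N u + N v"
proof (rule power2_le_imp_le)
  have "(N (\<lambda>x. u x + v x))\<^sup>2 = (N u)\<^sup>2 + 2 * B u v + (N v)\<^sup>2"
    using u v by (simp add: N_square add_left add_right add_mem commute[of v u])
  also have "\<dots> \<le> (N u + N v)\<^sup>2"
    using Cauchy_Schwarz[OF u v] by (simp add: power2_sum)
  finally show "(N (\<lambda>x. u x + v x))\<^sup>2 \<le> (N u + N v)\<^sup>2" .
qed (use u v in simp)

lemma N_scale: "u \<in> V \<Longrightarrow> N (\<lambda>x. c * u x) = \<bar>c\<bar> * N u"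
  by (simp add: N_def scale_left scale_right scale_mem real_sqrt_mult flip: mult.assoc power2_eq_square)

lemma N_minus_commute:
  assumes "u \<in> V" "v \<in> V"
  shows "N (\<lambda>x. u x - v x) = N (\<lambda>x. v x - u x)"
  using N_scale[OF diff_mem[OF assms], of "-1"] by simp

text \<open>The error splits into one product of two errors and two products of an error with a
  fixed vector. An arbitrary filter covers both sequences and limits in time; membership is required
  only eventually because \<open>S h u\<close> is known to lie in L2 only for nonnegative
  \<open>h\<close>.\<close>

lemma B_tendsto:
  assumes U: "\<forall>\<^sub>F n in F. U n \<in> V" and W: "\<forall>\<^sub>F n in F. W n \<in> V" and u: "u \<in> V" and w: "w \<in> V"
    and limU: "((\<lambda>n. N (\<lambda>x. U n x - u x)) \<longlongrightarrow> 0) F"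
    and limW: "((\<lambda>n. N (\<lambda>x. W n x - w x)) \<longlongrightarrow> 0) F"
  shows "((\<lambda>n. B (U n) (W n)) \<longlongrightarrow> B u w) F"
proof (rule LIM_zero_cancel, rule Lim_null_comparison)
  let ?a = "\<lambda>n. N (\<lambda>x. U n x - u x)" and ?b = "\<lambda>n. N (\<lambda>x. W n x - w x)"
  show "\<forall>\<^sub>F n in F. norm (B (U n) (W n) - B u w) \<le> ?a n * ?b n + ?a n * N w + N u * ?b n"
    using U W
  proof eventually_elim
    case (elim n)
    have "B (U n) (W n) - B u w = B (\<lambda>x. U n x - u x) (\<lambda>x. W n x - w x)
        + B (\<lambda>x. U n x - u x) w + B u (\<lambda>x. W n x - w x)"
      using elim u w by (simp add: diff_left diff_right diff_mem)
    moreover have "\<bar>B (\<lambda>x. U n x - u x) (\<lambda>x. W n x - w x)\<bar> \<le> ?a n * ?b n"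
      "\<bar>B (\<lambda>x. U n x - u x) w\<bar> \<le> ?a n * N w" "\<bar>B u (\<lambda>x. W n x - w x)\<bar> \<le> N u * ?b n"
      using elim u w by (intro Cauchy_Schwarz diff_mem; simp)+
    ultimately show ?case by simp
  qed
  show "((\<lambda>n. ?a n * ?b n + ?a n * N w + N u * ?b n) \<longlongrightarrow> 0) F"
    by (rule tendsto_eq_intros limU limW refl | simp)+
qed

end

section \<open>The space of square integrable functions\<close>

lemma L2_measurable: "u \<in> L2 m \<Longrightarrow> u \<in> borel_measurable m"
  by (simp add: L2_def)

lemma integrable_mult_L2:
  assumes u: "u \<in> L2 m" and v: "v \<in> L2 m"
  shows "integrable m (\<lambda>x. u x * v x)"
proof (rule Bochner_Integration.integrable_bound)
  show "integrable m (\<lambda>x. (u x)\<^sup>2 + (v x)\<^sup>2)" using u v by (auto simp: L2_def)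
  show "(\<lambda>x. u x * v x) \<in> borel_measurable m"
    using u v by (auto simp: L2_def)
  show "AE x in m. norm (u x * v x) \<le> norm ((u x)\<^sup>2 + (v x)\<^sup>2)"
  proof (rule AE_I2)
    fix x
    have "2 * (\<bar>u x\<bar> * \<bar>v x\<bar>) \<le> (u x)\<^sup>2 + (v x)\<^sup>2"
      using sum_squares_bound[of "\<bar>u x\<bar>" "\<bar>v x\<bar>"] by (simp add: mult.assoc)
    moreover have "0 \<le> \<bar>u x\<bar> * \<bar>v x\<bar>" by simp
    ultimately show "norm (u x * v x) \<le> norm ((u x)\<^sup>2 + (v x)\<^sup>2)"
      unfolding real_norm_def abs_mult by linarith
  qed
qed

lemma L2_add: "u \<in> L2 m \<Longrightarrow> v \<in> L2 m \<Longrightarrow> (\<lambda>x. u x + v x) \<in> L2 m"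
  using integrable_mult_L2[of u m v] unfolding L2_def
  by (auto simp: power2_sum mult.assoc)

lemma L2_scale: "u \<in> L2 m \<Longrightarrow> (\<lambda>x. c * u x) \<in> L2 m"
  by (auto simp: L2_def power_mult_distrib)

interpretation l2: semi_inner "L2 m" "l2_inner m"
proof
  show "l2_inner m (\<lambda>x. u x + v x) w = l2_inner m u w + l2_inner m v w"
    if "u \<in> L2 m" "v \<in> L2 m" "w \<in> L2 m" for u v w
    using that by (simp add: l2_inner_def distrib_right integrable_mult_L2)
  show "l2_inner m u w = l2_inner m w u" for u w
    by (simp add: l2_inner_def mult.commute)
qed (auto simp: L2_add L2_scale l2_inner_def mult.assoc)

lemma l2_N [simp]: "l2.N m = l2_norm m"
  by (rule ext) (simp add: l2.N_def l2_norm_def)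

lemma l2_norm_nonneg [simp]: "0 \<le> l2_norm m u"
  by (simp add: l2_norm_def l2_inner_def)

lemma l2_inner_cong_AE:
  assumes "u \<in> borel_measurable m" "u' \<in> borel_measurable m" "v \<in> borel_measurable m"
    "v' \<in> borel_measurable m" "AE x in m. u x = u' x" "AE x in m. v x = v' x"
  shows "l2_inner m u v = l2_inner m u' v'"
  unfolding l2_inner_def using assms by (intro integral_cong_AE) auto

lemma l2_norm_cong_AE:
  assumes "u \<in> borel_measurable m" "v \<in> borel_measurable m" "AE x in m. u x = v x"
  shows "l2_norm m u = l2_norm m v"
  using l2_inner_cong_AE[OF assms(1,2,1,2,3,3)] by (simp add: l2_norm_def)

lemma L2_cong_AE:
  assumes "u \<in> L2 m" "v \<in> borel_measurable m" "AE x in m. v x = u x"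
  shows "v \<in> L2 m"
proof -
  have "integrable m (\<lambda>x. (v x)\<^sup>2)"
    using assms by (subst integrable_cong_AE[where g = "\<lambda>x. (u x)\<^sup>2"]) (auto simp: L2_def)
  then show ?thesis using assms by (simp add: L2_def)
qed

lemma l2_norm_eq_0_iff:
  assumes "u \<in> L2 m"
  shows "l2_norm m u = 0 \<longleftrightarrow> (AE x in m. u x = 0)"
  using assms integral_nonneg_eq_0_iff_AE[of m "\<lambda>x. u x * u x"]
  by (simp add: l2_norm_def l2_inner_def integrable_mult_L2)

lemma AE_eq_if_l2_norm_diff:
  assumes "u \<in> L2 m" "v \<in> L2 m" "l2_norm m (\<lambda>x. u x - v x) = 0"
  shows "AE x in m. u x = v x"
  using l2_norm_eq_0_iff[OF l2.diff_mem[OF assms(1,2)]] assms(3) by simp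

lemma zero_L2: "(\<lambda>_. 0) \<in> L2 m"
  by (simp add: L2_def)

lemma indicator_L2:
  assumes "A \<in> sets m" "emeasure m A < \<infinity>"
  shows "(indicator A :: 'a \<Rightarrow> real) \<in> L2 m"
  using assms by (simp add: L2_def power2_eq_square flip: indicator_inter_arith)

text \<open>Testing the difference on the part of an exhausting set where it has a given sign yields
  a vanishing integral of a nonnegative function.\<close>

lemma (in sigma_finite_measure) AE_eq_if_inner_indicator_eq:
  assumes u: "u \<in> L2 M" and v: "v \<in> L2 M"
    and eq: "\<And>A. A \<in> sets M \<Longrightarrow> emeasure M A < \<infinity> \<Longrightarrow>
      l2_inner M u (indicator A) = l2_inner M v (indicator A)"
  shows "AE x in M. u x = v x"
proof -
  obtain A :: "nat \<Rightarrow> 'a set" where A: "range A \<subseteq> sets M" "(\<Union>i. A i) = space M"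
      "\<And>i. emeasure M (A i) \<noteq> \<infinity>" using sigma_finite by metis
  define w where "w x = u x - v x" for x
  have wL: "w \<in> L2 M" unfolding w_def using u v by (rule l2.diff_mem)
  then have wm[measurable]: "w \<in> borel_measurable M" by (rule L2_measurable)
  have "AE x in M. x \<in> A i \<longrightarrow> w x = 0" for i
  proof -
    have Ai: "A i \<in> sets M" using A by auto
    have zero: "l2_inner M w (indicator C) = 0"
      if "C \<in> sets M" "emeasure M C < \<infinity>" for C
      unfolding w_def using eq[OF that] u v indicator_L2[OF that] by (simp add: l2.diff_left)
    \<comment> \<open>The factor \<open>s\<close> is 1 or -1 and selects the sign of
      \<open>w\<close> that is treated.\<close>
    have "AE x in M. indicator (A i \<inter> C) x * (s * w x) = 0"
      if C: "C = {x \<in> space M. 0 \<le> s * w x}" for C and s :: real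
    proof -
      have Cs: "A i \<inter> C \<in> sets M" using Ai unfolding C by measurable
      have fin: "emeasure M (A i \<inter> C) < \<infinity>"
        using emeasure_mono[of "A i \<inter> C" "A i" M] A(3)[of i] Ai
        by (auto simp: less_top top_unique)
      note iL = indicator_L2[OF Cs fin]
      have "(\<integral>x. indicator (A i \<inter> C) x * (s * w x) \<partial>M) = s * l2_inner M w (indicator (A i \<inter> C))"
        by (simp add: l2_inner_def mult_ac flip: integral_mult_right_zero)
      then have int0: "(\<integral>x. indicator (A i \<inter> C) x * (s * w x) \<partial>M) = 0"
        using zero[OF Cs fin] by simp
      have "integrable M (\<lambda>x. indicator (A i \<inter> C) x * (s * w x))"
        by (intro integrable_mult_L2 iL L2_scale wL)
      then show ?thesis
        using int0 by (subst (asm) integral_nonneg_eq_0_iff_AE) (auto simp: C indicator_def)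
    qed
    from this[OF refl, of 1] this[OF refl, of "-1"] show ?thesis
      using AE_space by eventually_elim (auto simp: indicator_def split: if_splits)
  qed
  then have "AE x in M. \<forall>i. x \<in> A i \<longrightarrow> w x = 0" by (subst AE_all_countable) blast
  then show ?thesis using AE_space
  proof eventually_elim
    case (elim x)
    then obtain i where "x \<in> A i" using A(2) by blast
    then show ?case using elim by (auto simp: w_def)
  qed
qed

text \<open>The difference \<open>?z\<close> is orthogonal to \<open>D\<close>, so its squared norm
  equals its inner product with \<open>?z - w\<close> for every \<open>w\<close> in
  \<open>D\<close>, and \<open>w\<close> can be taken within \<open>e\<close> of
  \<open>?z\<close>.\<close>

lemma AE_eq_if_inner_eq_on_dense:
  assumes D: "l2_dense m D" and u: "u \<in> L2 m" and v: "v \<in> L2 m"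
    and eq: "\<And>w. w \<in> D \<Longrightarrow> l2_inner m u w = l2_inner m v w"
  shows "AE x in m. u x = v x"
proof -
  let ?z = "\<lambda>x. u x - v x"
  have z: "?z \<in> L2 m" using u v by (rule l2.diff_mem)
  have "l2_norm m ?z \<le> 0"
  proof (rule field_le_epsilon)
    fix e :: real assume "e > 0"
    then obtain w where w: "w \<in> D" "l2_norm m (\<lambda>x. ?z x - w x) < e"
      using D z unfolding l2_dense_def by meson
    then have wL: "w \<in> L2 m" using D by (auto simp: l2_dense_def)
    have "(l2_norm m ?z)\<^sup>2 = l2_inner m ?z ?z" using l2.N_square[OF z] by simp
    also have "\<dots> = l2_inner m ?z (\<lambda>x. ?z x - w x) + (l2_inner m u w - l2_inner m v w)"
      using u v z wL l2.diff_right[OF z wL z] l2.diff_left[OF u v wL] by simp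
    also have "\<dots> = l2_inner m ?z (\<lambda>x. ?z x - w x)" using eq w by simp
    also have "\<dots> \<le> l2_norm m ?z * l2_norm m (\<lambda>x. ?z x - w x)"
      using l2.Cauchy_Schwarz[OF z l2.diff_mem[OF z wL]] by simp
    also have "\<dots> \<le> l2_norm m ?z * e"
      using w by (intro mult_left_mono) auto
    finally have "l2_norm m ?z * l2_norm m ?z \<le> l2_norm m ?z * e"
      by (simp add: power2_eq_square)
    then show "l2_norm m ?z \<le> 0 + e"
      using \<open>e > 0\<close> by (cases "l2_norm m ?z = 0") (auto simp: less_le)
  qed
  then have "l2_norm m ?z = 0" by (simp add: antisym)
  with u v show ?thesis by (rule AE_eq_if_l2_norm_diff)
qed

section \<open>The Friedrichs extension\<close>

lemma l2_operatorD:
  assumes "l2_operator m G"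
  shows "(u, v) \<in> G \<Longrightarrow> u \<in> L2 m" "(u, v) \<in> G \<Longrightarrow> v \<in> L2 m"
    "(u, v) \<in> G \<Longrightarrow> (u, v') \<in> G \<Longrightarrow> AE x in m. v x = v' x"
    "(u, v) \<in> G \<Longrightarrow> (u', v') \<in> G \<Longrightarrow> ((\<lambda>x. u x + u' x), (\<lambda>x. v x + v' x)) \<in> G"
    "(u, v) \<in> G \<Longrightarrow> ((\<lambda>x. c * u x), (\<lambda>x. c * v x)) \<in> G"
    "((\<lambda>_. 0), (\<lambda>_. 0)) \<in> G"
proof -
  note c = assms[unfolded l2_operator_def]
  note c2 = conjunct2[OF conjunct2[OF c]]
  note c4 = conjunct2[OF conjunct2[OF c2]]
  show "(u, v) \<in> G \<Longrightarrow> u \<in> L2 m" "(u, v) \<in> G \<Longrightarrow> v \<in> L2 m"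
    using conjunct1[OF c] by blast+
  show "(u, v) \<in> G \<Longrightarrow> (u, v') \<in> G \<Longrightarrow> AE x in m. v x = v' x"
    using conjunct1[OF c2] by blast
  show "((\<lambda>_. 0), (\<lambda>_. 0)) \<in> G" by (rule conjunct1[OF conjunct2[OF c2]])
  show "(u, v) \<in> G \<Longrightarrow> (u', v') \<in> G \<Longrightarrow> ((\<lambda>x. u x + u' x), (\<lambda>x. v x + v' x)) \<in> G"
    using conjunct1[OF c4] by blast
  show "(u, v) \<in> G \<Longrightarrow> ((\<lambda>x. c * u x), (\<lambda>x. c * v x)) \<in> G"
    using conjunct2[OF c4] by blast
qed

locale upper_bounded_symmetric =
  fixes m :: "'a measure" and G :: "'a l2_graph"
  assumes operator: "l2_operator m G"
    and dense: "l2_dense m (Domain G)"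
    and symmetric: "l2_symmetric m G"
    and bounded: "upper_bounded m G"
begin

abbreviation "D \<equiv> Domain G"
abbreviation "Q \<equiv> form_of m G"
abbreviation "F \<equiv> form_closure_domain m D Q"
abbreviation "q \<equiv> form_closure m D Q"
abbreviation "approx \<equiv> form_approx m D Q"

lemmas graph_L2 = l2_operatorD(1,2)[OF operator]

lemma D_L2: "u \<in> D \<Longrightarrow> u \<in> L2 m"
  using graph_L2 by blast

text \<open>\<open>form_of\<close> selects an image by \<open>SOME\<close>; the operator is
  single-valued up to a.e. equality, so any image gives the same inner product.\<close>

lemma Q_eq:
  assumes "(u, w) \<in> G" "v \<in> L2 m"
  shows "Q u v = l2_inner m w v"
proof -
  have "(u, SOME w. (u, w) \<in> G) \<in> G" using assms(1) by (rule someI[where P = "\<lambda>w. (u, w) \<in> G"])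
  then have "(SOME w. (u, w) \<in> G) \<in> L2 m" "AE x in m. (SOME w. (u, w) \<in> G) x = w x"
    using graph_L2(2) l2_operatorD(3)[OF operator _ assms(1)] by blast+
  then show ?thesis
    unfolding form_of_def using assms graph_L2(2)[OF assms(1)]
    by (intro l2_inner_cong_AE) (auto intro: L2_measurable)
qed

lemma Q_commute: "u \<in> D \<Longrightarrow> v \<in> D \<Longrightarrow> Q u v = Q v u"
proof (elim DomainE)
  fix w z assume uw: "(u, w) \<in> G" and vz: "(v, z) \<in> G"
  have "l2_inner m w v = l2_inner m u z"
    using symmetric uw vz by (auto simp: l2_symmetric_def l2_adjoint_def)
  then show "Q u v = Q v u"
    using graph_L2[OF uw] graph_L2[OF vz] Q_eq[OF uw] Q_eq[OF vz] l2.commute by metis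
qed

lemma D_add: "u \<in> D \<Longrightarrow> v \<in> D \<Longrightarrow> (\<lambda>x. u x + v x) \<in> D"
  using l2_operatorD(4)[OF operator] by blast

lemma D_scale: "u \<in> D \<Longrightarrow> (\<lambda>x. c * u x) \<in> D"
  using l2_operatorD(5)[OF operator] by blast

lemma Q_add:
  assumes "u \<in> D" "v \<in> D" "w \<in> L2 m"
  shows "Q (\<lambda>x. u x + v x) w = Q u w + Q v w"
proof -
  from assms obtain u' v' where uv: "(u, u') \<in> G" "(v, v') \<in> G" by blast
  show ?thesis
    using Q_eq[OF l2_operatorD(4)[OF operator uv] assms(3)] Q_eq[OF uv(1) assms(3)]
      Q_eq[OF uv(2) assms(3)] l2.add_left[OF graph_L2(2)[OF uv(1)] graph_L2(2)[OF uv(2)] assms(3)]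
    by simp
qed

lemma Q_scale:
  assumes "u \<in> D" "w \<in> L2 m"
  shows "Q (\<lambda>x. c * u x) w = c * Q u w"
proof -
  from assms obtain u' where u: "(u, u') \<in> G" by blast
  show ?thesis
    using Q_eq[OF l2_operatorD(5)[OF operator u] assms(2)] Q_eq[OF u(1) assms(2)]
      l2.scale_left[OF graph_L2(2)[OF u] assms(2)]
    by simp
qed

lemma Q_bound: obtains C where "C \<ge> 0" "\<And>u. u \<in> D \<Longrightarrow> Q u u \<le> C * (l2_norm m u)\<^sup>2"
proof -
  obtain C where C: "\<And>u v. (u, v) \<in> G \<Longrightarrow> l2_norm m u \<noteq> 0 \<Longrightarrow>
      l2_inner m v u / (l2_norm m u)\<^sup>2 \<le> C"
    using bounded unfolding upper_bounded_def bdd_above_def by blast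
  show ?thesis
  \<comment> \<open>The supremum may be negative, but the shift \<open>C + 1\<close> has to be
    positive.\<close>
  proof (rule that[of "max C 0"])
    fix u assume "u \<in> D"
    then obtain v where uv: "(u, v) \<in> G" by blast
    note L = graph_L2[OF uv]
    show "Q u u \<le> max C 0 * (l2_norm m u)\<^sup>2"
    proof (cases "l2_norm m u = 0")
      case True
      then have "l2_inner m v u = 0" using l2.Cauchy_Schwarz[OF L(2,1)] by simp
      then show ?thesis using True Q_eq[OF uv L(1)] by simp
    next
      case False
      then have "l2_inner m v u \<le> C * (l2_norm m u)\<^sup>2"
        using C[OF uv False] by (simp add: divide_le_eq)
      also have "\<dots> \<le> max C 0 * (l2_norm m u)\<^sup>2" by (intro mult_right_mono) auto
      finally show ?thesis using Q_eq[OF uv L(1)] by simp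
    qed
  qed simp
qed

section \<open>The shifted form and its norm\<close>

definition C where "C = (SOME C. C \<ge> 0 \<and> (\<forall>u\<in>D. Q u u \<le> C * (l2_norm m u)\<^sup>2))"

lemma C: "C \<ge> 0" "\<And>u. u \<in> D \<Longrightarrow> Q u u \<le> C * (l2_norm m u)\<^sup>2"
proof -
  have "C \<ge> 0 \<and> (\<forall>u\<in>D. Q u u \<le> C * (l2_norm m u)\<^sup>2)"
    unfolding C_def by (rule someI_ex) (metis Q_bound)
  then show "C \<ge> 0" "\<And>u. u \<in> D \<Longrightarrow> Q u u \<le> C * (l2_norm m u)\<^sup>2" by auto
qed

text \<open>The square of the form norm, polarized. The shift by \<open>C\<close> alone makes the
  form nonnegative; the extra 1 makes it dominate the L2 inner product on the diagonal.\<close>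

definition P where "P u v = (C + 1) * l2_inner m u v - Q u v"

lemma P_ge: "u \<in> D \<Longrightarrow> (l2_norm m u)\<^sup>2 \<le> P u u"
  using C(2)[of u] l2.N_square[OF D_L2, of u] by (simp add: P_def algebra_simps)

sublocale P: semi_inner D P
proof
  show "0 \<le> P u u" if "u \<in> D" for u
    using P_ge[OF that] zero_le_power2 order_trans by blast
  show "P u w = P w u" if "u \<in> D" "w \<in> D" for u w
    using Q_commute[OF that] l2.commute[OF that[THEN D_L2]] by (simp add: P_def)
  show "P (\<lambda>x. u x + v x) w = P u w + P v w" if "u \<in> D" "v \<in> D" "w \<in> D" for u v w
    using that[THEN D_L2] by (simp add: P_def Q_add that l2.add_left algebra_simps)
  show "P (\<lambda>x. c * u x) w = c * P u w" if "u \<in> D" "w \<in> D" for u w c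
    using that[THEN D_L2] by (simp add: P_def Q_scale that l2.scale_left algebra_simps)
qed (auto intro: D_add D_scale)

lemma Q_eq_P: "Q u v = (C + 1) * l2_inner m u v - P u v"
  by (simp add: P_def)

section \<open>Approximating sequences and closability\<close>

lemma approx_D: "approx U u \<Longrightarrow> U n \<in> D"
  by (auto simp: form_approx_def)

lemma approx_L2: "approx U u \<Longrightarrow> u \<in> L2 m"
  by (simp add: form_approx_def)

lemma approx_tendsto: "approx U u \<Longrightarrow> (\<lambda>n. l2_norm m (\<lambda>x. U n x - u x)) \<longlonglongrightarrow> 0"
  by (simp add: form_approx_def)

lemma l2_inner_approx_tendsto:
  assumes "approx U u" "approx V v"
  shows "(\<lambda>n. l2_inner m (U n) (V n)) \<longlonglongrightarrow> l2_inner m u v"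
  by (rule l2.B_tendsto)
     (use assms in \<open>auto intro: always_eventually approx_L2 approx_D[THEN D_L2] approx_tendsto\<close>)

text \<open>\<open>form_approx\<close> controls the L2 distance and \<open>Q\<close> separately.
  Each contributes at most half of \<open>e\<^sup>2\<close> to \<open>P\<close>, which turns the two
  conditions into one for a norm with a triangle inequality.\<close>

lemma approx_Cauchy:
  assumes "approx U u" "e > 0"
  obtains K where "\<And>i j. i \<ge> K \<Longrightarrow> j \<ge> K \<Longrightarrow> P.N (\<lambda>x. U i x - U j x) < e"
proof -
  \<comment> \<open>Chosen so that \<open>(C + 1) * ?d\<close> is \<open>e\<^sup>2 / 2\<close>;
    below, each of the two distances to the limit is at most half of \<open>sqrt ?d\<close>.\<close>
  let ?d = "e\<^sup>2 / (2 * (C + 1))"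
  have C1: "C + 1 > 0" using C(1) by simp
  have e2: "e\<^sup>2 / 2 > 0" using assms(2) by simp
  obtain K1 where K1: "\<And>i j. i \<ge> K1 \<Longrightarrow> j \<ge> K1 \<Longrightarrow>
      \<bar>Q (\<lambda>x. U i x - U j x) (\<lambda>x. U i x - U j x)\<bar> < e\<^sup>2 / 2"
    using assms(1) e2 unfolding form_approx_def by meson
  have "sqrt ?d / 2 > 0" using C1 assms(2) by simp
  then have "\<forall>\<^sub>F n in sequentially. l2_norm m (\<lambda>x. U n x - u x) < sqrt ?d / 2"
    by (rule order_tendstoD(2)[OF approx_tendsto[OF assms(1)]])
  then obtain K2 where K2: "\<And>n. n \<ge> K2 \<Longrightarrow> l2_norm m (\<lambda>x. U n x - u x) < sqrt ?d / 2"
    by (auto simp: eventually_sequentially)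
  show ?thesis
  proof (rule that[of "max K1 K2"])
    fix i j assume ij: "i \<ge> max K1 K2" "j \<ge> max K1 K2"
    let ?z = "\<lambda>x. U i x - U j x"
    note UL = approx_D[OF assms(1), THEN D_L2]
    note uL = approx_L2[OF assms(1)]
    have z: "?z \<in> D" by (intro P.diff_mem approx_D[OF assms(1)])
    have "l2_norm m ?z \<le> l2_norm m (\<lambda>x. U i x - u x) + l2_norm m (\<lambda>x. u x - U j x)"
      using l2.triangle[OF l2.diff_mem[OF UL uL] l2.diff_mem[OF uL UL], of i j] by simp
    also have "l2_norm m (\<lambda>x. u x - U j x) = l2_norm m (\<lambda>x. U j x - u x)"
      using l2.N_minus_commute[OF uL UL] by simp
    finally have "l2_norm m ?z < sqrt ?d"
      using K2[of i] K2[of j] ij by simp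
    then have "(l2_norm m ?z)\<^sup>2 < (sqrt ?d)\<^sup>2" by (intro power_strict_mono) auto
    also have "\<dots> = ?d" using C1 by simp
    finally have "(C + 1) * (l2_norm m ?z)\<^sup>2 < e\<^sup>2 / 2"
      using C1 by (simp add: field_simps)
    then have "(C + 1) * l2_inner m ?z ?z < e\<^sup>2 / 2"
      using l2.N_square[OF D_L2[OF z]] by simp
    with K1[of i j] ij have "P ?z ?z < e\<^sup>2" by (simp add: P_def)
    then have "(P.N ?z)\<^sup>2 < e\<^sup>2" using P.N_square[OF z] by simp
    then show "P.N ?z < e" using assms(2) by (simp add: power2_less_imp_less)
  qed
qed

lemma approx_bounded:
  assumes "approx U u"
  obtains M where "M > 0" "\<And>n. P.N (U n) \<le> M"
proof -
  obtain K where K: "\<And>i j. i \<ge> K \<Longrightarrow> j \<ge> K \<Longrightarrow> P.N (\<lambda>x. U i x - U j x) < 1"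
    using approx_Cauchy[OF assms, of 1] by auto
  note UD = approx_D[OF assms]
  let ?M = "(\<Sum>i\<le>K. P.N (U i)) + 1"
  have s: "P.N (U i) \<le> (\<Sum>i\<le>K. P.N (U i))" if "i \<le> K" for i
    using that UD by (intro member_le_sum) auto
  have "P.N (U n) \<le> ?M" for n
  proof (cases "n \<le> K")
    case True then show ?thesis using s[OF True] by simp
  next
    case False
    have "P.N (U n) \<le> P.N (\<lambda>x. U n x - U K x) + P.N (U K)"
      using P.triangle[OF P.diff_mem[OF UD UD] UD, of n K K] by simp
    then show ?thesis using K[of n K] s[of K] False by simp
  qed
  moreover have "?M > 0" using UD by (intro add_nonneg_pos sum_nonneg) auto
  ultimately show ?thesis by (intro that[of ?M]) auto
qed

text \<open>\<open>Q\<close> has no triangle inequality, so the Cauchy condition is passed to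
  \<open>P.N\<close>, added there, and passed back to \<open>Q\<close>.\<close>

lemma approx_add:
  assumes "approx U u" "approx V v"
  shows "approx (\<lambda>n x. U n x + V n x) (\<lambda>x. u x + v x)"
proof -
  note D = approx_D[OF assms(1)] approx_D[OF assms(2)]
  note L = approx_L2[OF assms(1)] approx_L2[OF assms(2)] D[THEN D_L2]
  have lim: "(\<lambda>n. l2_norm m (\<lambda>x. (U n x + V n x) - (u x + v x))) \<longlonglongrightarrow> 0"
  proof (rule Lim_null_comparison)
    show "(\<lambda>n. l2_norm m (\<lambda>x. U n x - u x) + l2_norm m (\<lambda>x. V n x - v x)) \<longlonglongrightarrow> 0"
      using tendsto_add[OF approx_tendsto[OF assms(1)] approx_tendsto[OF assms(2)]] by simp
    have "l2_norm m (\<lambda>x. U n x + V n x - (u x + v x)) \<le>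
        l2_norm m (\<lambda>x. U n x - u x) + l2_norm m (\<lambda>x. V n x - v x)" for n
      using l2.triangle[OF l2.diff_mem[OF L(3)[of n] L(1)] l2.diff_mem[OF L(4)[of n] L(2)]]
      by (simp add: algebra_simps)
    then show "\<forall>\<^sub>F n in sequentially. norm (l2_norm m (\<lambda>x. U n x + V n x - (u x + v x))) \<le>
        l2_norm m (\<lambda>x. U n x - u x) + l2_norm m (\<lambda>x. V n x - v x)"
      by simp
  qed
  have "\<exists>K. \<forall>i\<ge>K. \<forall>j\<ge>K. \<bar>Q (\<lambda>x. (U i x + V i x) - (U j x + V j x))
      (\<lambda>x. (U i x + V i x) - (U j x + V j x))\<bar> < e" if e: "e > 0" for e
  proof -
    let ?W = "\<lambda>n x. U n x + V n x" and ?w = "\<lambda>x. u x + v x"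
    have C1: "C + 1 > 0" using C(1) by simp
    \<comment> \<open>The factor comes from the estimate of the absolute value of
      \<open>Q ?z ?z\<close> by \<open>(C + 2) * P ?z ?z\<close>; the sum of the two differences has
      norm below \<open>2 * d\<close>, whose square is \<open>e / (C + 2)\<close>.\<close>
    define d where "d = sqrt (e / (C + 2)) / 2"
    have d: "d > 0" using e C1 by (simp add: d_def)
    obtain K1 where K1: "\<And>i j. i \<ge> K1 \<Longrightarrow> j \<ge> K1 \<Longrightarrow> P.N (\<lambda>x. U i x - U j x) < d"
      using approx_Cauchy[OF assms(1) d] by blast
    obtain K2 where K2: "\<And>i j. i \<ge> K2 \<Longrightarrow> j \<ge> K2 \<Longrightarrow> P.N (\<lambda>x. V i x - V j x) < d"
      using approx_Cauchy[OF assms(2) d] by blast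
    show ?thesis
    proof (intro exI[of _ "max K1 K2"] allI impI)
      fix i j assume ij: "max K1 K2 \<le> i" "max K1 K2 \<le> j"
      let ?z = "\<lambda>x. ?W i x - ?W j x"
      have z: "?z \<in> D" by (intro P.diff_mem P.add_mem D)
      have "P.N ?z \<le> P.N (\<lambda>x. U i x - U j x) + P.N (\<lambda>x. V i x - V j x)"
        using P.triangle[OF P.diff_mem[OF D(1)[of i] D(1)[of j]] P.diff_mem[OF D(2)[of i] D(2)[of j]]]
        by (simp add: algebra_simps)
      also have "\<dots> < 2 * d" using K1[of i j] K2[of i j] ij by simp
      finally have "(P.N ?z)\<^sup>2 < (2 * d)\<^sup>2" by (intro power_strict_mono) (use z in auto)
      also have "(2 * d)\<^sup>2 = e / (C + 2)" using e C1 by (simp add: d_def)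
      finally have Pz: "P ?z ?z < e / (C + 2)" using P.N_square[OF z] by simp
      have nz: "l2_inner m ?z ?z \<le> P ?z ?z" using P_ge[OF z] l2.N_square[OF D_L2[OF z]] by simp
      have Pz0: "0 \<le> P ?z ?z" and lz0: "0 \<le> l2_inner m ?z ?z"
        using P.nonneg[OF z] l2.nonneg[OF D_L2[OF z]] by auto
      have "\<bar>Q ?z ?z\<bar> \<le> (C + 1) * l2_inner m ?z ?z + P ?z ?z"
        unfolding Q_eq_P using Pz0 lz0 C1 by (simp add: abs_le_iff)
      also have "\<dots> \<le> (C + 1) * P ?z ?z + P ?z ?z"
        using nz C1 by (intro add_right_mono mult_left_mono) auto
      also have "\<dots> = (C + 2) * P ?z ?z" by (simp add: algebra_simps)
      also have "\<dots> < e" using Pz C1 by (simp add: field_simps)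
      finally show "\<bar>Q ?z ?z\<bar> < e" .
    qed
  qed
  with lim show ?thesis
    using D L unfolding form_approx_def by (auto intro: L2_add P.add_mem)
qed

lemma approx_scale:
  assumes "approx U u"
  shows "approx (\<lambda>n x. c * U n x) (\<lambda>x. c * u x)"
proof -
  note D = approx_D[OF assms(1)]
  note L = approx_L2[OF assms(1)] D[THEN D_L2]
  have eq: "l2_norm m (\<lambda>x. c * U n x - c * u x) = \<bar>c\<bar> * l2_norm m (\<lambda>x. U n x - u x)" for n
    using l2.N_scale[OF l2.diff_mem[OF L(2)[of n] L(1)], of c] by (simp add: algebra_simps)
  have lim: "(\<lambda>n. l2_norm m (\<lambda>x. c * U n x - c * u x)) \<longlonglongrightarrow> 0"
    unfolding eq using tendsto_mult_right_zero[OF approx_tendsto[OF assms]] .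
  have Qeq: "Q (\<lambda>x. c * U i x - c * U j x) (\<lambda>x. c * U i x - c * U j x)
      = c\<^sup>2 * Q (\<lambda>x. U i x - U j x) (\<lambda>x. U i x - U j x)" for i j
  proof -
    let ?z = "\<lambda>x. U i x - U j x"
    have z: "?z \<in> D" by (intro P.diff_mem D)
    have cz: "(\<lambda>x. c * ?z x) \<in> D" by (rule D_scale[OF z])
    have "Q (\<lambda>x. c * ?z x) (\<lambda>x. c * ?z x) = c * Q ?z (\<lambda>x. c * ?z x)"
      by (rule Q_scale[OF z D_L2[OF cz]])
    also have "\<dots> = c * Q (\<lambda>x. c * ?z x) ?z" using Q_commute[OF z cz] by simp
    also have "\<dots> = c\<^sup>2 * Q ?z ?z" using Q_scale[OF z D_L2[OF z], of c] by (simp add: power2_eq_square)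
    finally show ?thesis by (simp add: right_diff_distrib)
  qed
  have "\<exists>K. \<forall>i\<ge>K. \<forall>j\<ge>K. \<bar>Q (\<lambda>x. c * U i x - c * U j x) (\<lambda>x. c * U i x - c * U j x)\<bar> < e"
    if e: "e > 0" for e
  proof -
    \<comment> \<open>Adding 1 covers the case \<open>c = 0\<close>.\<close>
    have "e / (c\<^sup>2 + 1) > 0" using e by (simp add: add_nonneg_pos)
    then obtain K where K: "\<And>i j. i \<ge> K \<Longrightarrow> j \<ge> K \<Longrightarrow>
        \<bar>Q (\<lambda>x. U i x - U j x) (\<lambda>x. U i x - U j x)\<bar> < e / (c\<^sup>2 + 1)"
      using assms unfolding form_approx_def by meson
    show ?thesis
    proof (intro exI[of _ K] allI impI)
      fix i j assume "K \<le> i" "K \<le> j"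
      let ?q = "\<bar>Q (\<lambda>x. U i x - U j x) (\<lambda>x. U i x - U j x)\<bar>"
      have "?q < e / (c\<^sup>2 + 1)" using K \<open>K \<le> i\<close> \<open>K \<le> j\<close> .
      then have "?q * (c\<^sup>2 + 1) < e" by (simp add: pos_less_divide_eq add_nonneg_pos)
      moreover have "c\<^sup>2 * ?q \<le> ?q * (c\<^sup>2 + 1)" by (simp add: algebra_simps)
      ultimately show "\<bar>Q (\<lambda>x. c * U i x - c * U j x) (\<lambda>x. c * U i x - c * U j x)\<bar> < e"
        unfolding Qeq by (simp add: abs_mult)
    qed
  qed
  with lim show ?thesis
    using D L unfolding form_approx_def by (auto intro: L2_scale D_scale)
qed

lemma approx_const: "u \<in> D \<Longrightarrow> approx (\<lambda>_. u) u"
proof -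
  assume u: "u \<in> D"
  have z: "(\<lambda>_. 0, \<lambda>_. 0) \<in> G" by (rule l2_operatorD(6)[OF operator])
  show ?thesis
    using D_L2[OF u] u Q_eq[OF z zero_L2]
    by (auto simp: form_approx_def l2_norm_def l2_inner_def)
qed

lemma approx_diff:
  assumes "approx U u" "approx V v"
  shows "approx (\<lambda>n x. U n x - V n x) (\<lambda>x. u x - v x)"
  using approx_add[OF assms(1) approx_scale[OF assms(2), of "-1"]] by simp

text \<open>Closability: a form-Cauchy sequence that tends to 0 in L2 tends to 0 in form norm, because
  \<open>P (W n) (W k)\<close> is an L2 inner product with \<open>W k\<close> and hence tends to 0 as k grows.\<close>

lemma approx_zero_tendsto:
  assumes W: "approx W w" and w: "AE x in m. w x = 0"
  shows "(\<lambda>n. P.N (W n)) \<longlonglongrightarrow> 0"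
proof -
  note D = approx_D[OF W]
  obtain M where M: "M > 0" "\<And>n. P.N (W n) \<le> M" using approx_bounded[OF W] by blast
  have wL: "w \<in> L2 m" by (rule approx_L2[OF W])
  have w0: "l2_inner m v w = 0" if "v \<in> L2 m" for v
    using l2.Cauchy_Schwarz[OF that wL] l2_norm_eq_0_iff[OF wL] w by simp
  have lim0: "(\<lambda>k. P (W n) (W k)) \<longlonglongrightarrow> 0" for n
  proof -
    obtain z where z: "(W n, z) \<in> G" using D[of n] by blast
    have c: "(\<lambda>k. l2_inner m v (W k)) \<longlonglongrightarrow> 0" if v: "v \<in> L2 m" for v
    proof -
      have "(\<lambda>k. l2_inner m v (W k)) \<longlonglongrightarrow> l2_inner m v w"
        by (rule l2.B_tendsto)
           (use v wL D[THEN D_L2] approx_tendsto[OF W] in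
             \<open>auto simp: l2_norm_def l2_inner_def\<close>)
      then show ?thesis using w0[OF v] by simp
    qed
    have "(\<lambda>k. (C + 1) * l2_inner m (W n) (W k) - l2_inner m z (W k)) \<longlonglongrightarrow> (C + 1) * 0 - 0"
      by (intro tendsto_intros c graph_L2[OF z])
    then show ?thesis using Q_eq[OF z D[THEN D_L2]] by (simp add: P_def)
  qed
  have "(\<lambda>n. P (W n) (W n)) \<longlonglongrightarrow> 0"
  proof (rule LIMSEQ_I)
    fix e :: real assume e: "e > 0"
    then have "e / (2 * M) > 0" using M by simp
    then obtain K where K: "\<And>i j. i \<ge> K \<Longrightarrow> j \<ge> K \<Longrightarrow> P.N (\<lambda>x. W i x - W j x) < e / (2 * M)"
      using approx_Cauchy[OF W] by blast
    show "\<exists>no. \<forall>n\<ge>no. norm (P (W n) (W n) - 0) < e"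
    proof (intro exI[of _ K] allI impI)
      fix n assume n: "n \<ge> K"
      \<comment> \<open>Split the second argument as \<open>W n - W k\<close> plus
        \<open>W k\<close>. The first part contributes at most \<open>M * (e / (2 * M))\<close> for
        large \<open>k\<close>, and the second disappears in the limit over \<open>k\<close> with
        \<open>n\<close> fixed.\<close>
      have "P (W n) (W n) \<le> e / 2"
      proof (rule tendsto_lowerbound)
        show "(\<lambda>k. e / 2 + P (W n) (W k)) \<longlonglongrightarrow> e / 2"
          using tendsto_add[OF tendsto_const lim0[of n], of "e / 2"] by simp
        show "\<forall>\<^sub>F k in sequentially. P (W n) (W n) \<le> e / 2 + P (W n) (W k)"
          using eventually_ge_at_top[of K]
        proof eventually_elim
          case (elim k)
          have "P (W n) (W n) - P (W n) (W k) = P (W n) (\<lambda>x. W n x - W k x)"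
            using P.diff_right[OF D[of n] D[of k] D[of n]] by simp
          also have "\<dots> \<le> P.N (W n) * P.N (\<lambda>x. W n x - W k x)"
            using P.Cauchy_Schwarz[OF D[of n] P.diff_mem[OF D[of n] D[of k]]] by simp
          also have "\<dots> \<le> M * (e / (2 * M))"
            using M K[OF n elim] P.N_nonneg[OF P.diff_mem[OF D[of n] D[of k]]]
            by (intro mult_mono) auto
          also have "\<dots> = e / 2" using M by simp
          finally show ?case by simp
        qed
      qed simp
      then show "norm (P (W n) (W n) - 0) < e" using P.nonneg[OF D[of n]] e by simp
    qed
  qed
  then show ?thesis
    unfolding P.N_def using tendsto_real_sqrt[of _ 0] by fastforce
qed

text \<open>Bounded times Cauchy, by Cauchy-Schwarz for \<open>P\<close>. The values of
  \<open>Q\<close> differ from those of \<open>P\<close> by a multiple of L2 inner products, which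
  converge anyway.\<close>

lemma approx_convergent:
  assumes U: "approx U u" and V: "approx V v"
  shows "convergent (\<lambda>n. Q (U n) (V n))"
proof -
  note D = approx_D[OF U] approx_D[OF V]
  obtain M where M: "M > 0" "\<And>n. P.N (U n) \<le> M" using approx_bounded[OF U] by blast
  obtain M' where M': "M' > 0" "\<And>n. P.N (V n) \<le> M'" using approx_bounded[OF V] by blast
  have "Cauchy (\<lambda>n. P (U n) (V n))"
  proof (rule CauchyI)
    fix e :: real assume e: "e > 0"
    have "e / (2 * M) > 0" "e / (2 * M') > 0" using e M M' by auto
    then obtain K K' where
      K: "\<And>i j. i \<ge> K \<Longrightarrow> j \<ge> K \<Longrightarrow> P.N (\<lambda>x. V i x - V j x) < e / (2 * M)" and
      K': "\<And>i j. i \<ge> K' \<Longrightarrow> j \<ge> K' \<Longrightarrow> P.N (\<lambda>x. U i x - U j x) < e / (2 * M')"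
      using approx_Cauchy[OF U] approx_Cauchy[OF V] by metis
    show "\<exists>K. \<forall>i\<ge>K. \<forall>j\<ge>K. norm (P (U i) (V i) - P (U j) (V j)) < e"
    proof (intro exI[of _ "max K K'"] allI impI)
      fix i j assume ij: "max K K' \<le> i" "max K K' \<le> j"
      let ?a = "\<lambda>x. U i x - U j x" and ?b = "\<lambda>x. V i x - V j x"
      have ab: "?a \<in> D" "?b \<in> D" using D P.diff_mem by auto
      have eq: "P (U i) (V i) - P (U j) (V j) = P ?a (V i) + P (U j) ?b"
        using P.diff_left[OF D(1)[of i] D(1)[of j] D(2)[of i]]
          P.diff_right[OF D(2)[of i] D(2)[of j] D(1)[of j]] by simp
      have "\<bar>P ?a (V i)\<bar> \<le> P.N ?a * P.N (V i)" by (rule P.Cauchy_Schwarz[OF ab(1) D(2)])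
      also have "\<dots> \<le> P.N ?a * M'" using M' ab by (intro mult_left_mono) auto
      also have "\<dots> < e / (2 * M') * M'" using K'[of i j] ij M' by (intro mult_strict_right_mono) auto
      finally have 1: "\<bar>P ?a (V i)\<bar> < e / 2" using M' by simp
      have "\<bar>P (U j) ?b\<bar> \<le> P.N (U j) * P.N ?b" by (rule P.Cauchy_Schwarz[OF D(1) ab(2)])
      also have "\<dots> \<le> M * P.N ?b" using M ab by (intro mult_right_mono) auto
      also have "\<dots> < M * (e / (2 * M))" using K[of i j] ij M by (intro mult_strict_left_mono) auto
      finally have 2: "\<bar>P (U j) ?b\<bar> < e / 2" using M by simp
      show "norm (P (U i) (V i) - P (U j) (V j)) < e" using 1 2 eq by simp
    qed
  qed
  then have "convergent (\<lambda>n. P (U n) (V n))" by (simp add: Cauchy_convergent)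
  then obtain c where "(\<lambda>n. P (U n) (V n)) \<longlonglongrightarrow> c" by (auto simp: convergent_def)
  then have "(\<lambda>n. (C + 1) * l2_inner m (U n) (V n) - P (U n) (V n)) \<longlonglongrightarrow> (C + 1) * l2_inner m u v - c"
    by (intro tendsto_intros l2_inner_approx_tendsto[OF U V])
  then show ?thesis unfolding convergent_def Q_eq_P by blast
qed

text \<open>In the \<open>P\<close> part the first factor tends to 0 in form norm by closability
  while the second stays bounded; the L2 part tends to the inner product of \<open>w\<close> and
  \<open>v\<close>, which is 0.\<close>

lemma approx_zero_Q_tendsto:
  assumes W: "approx W w" and w: "AE x in m. w x = 0" and V: "approx V v"
  shows "(\<lambda>n. Q (W n) (V n)) \<longlonglongrightarrow> 0"
proof -
  note D = approx_D[OF W] approx_D[OF V]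
  obtain M where M: "M > 0" "\<And>n. P.N (V n) \<le> M" using approx_bounded[OF V] by blast
  have "(\<lambda>n. P (W n) (V n)) \<longlonglongrightarrow> 0"
  proof (rule Lim_null_comparison)
    show "(\<lambda>n. P.N (W n) * M) \<longlonglongrightarrow> 0"
      by (rule tendsto_mult_left_zero[OF approx_zero_tendsto[OF W w]])
    have "norm (P (W n) (V n)) \<le> P.N (W n) * M" for n
    proof -
      have "\<bar>P (W n) (V n)\<bar> \<le> P.N (W n) * P.N (V n)" by (rule P.Cauchy_Schwarz[OF D])
      also have "\<dots> \<le> P.N (W n) * M" using M D by (intro mult_left_mono) auto
      finally show ?thesis by simp
    qed
    then show "\<forall>\<^sub>F n in sequentially. norm (P (W n) (V n)) \<le> P.N (W n) * M" by simp
  qed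
  moreover have "(\<lambda>n. l2_inner m (W n) (V n)) \<longlonglongrightarrow> 0"
  proof -
    have "l2_inner m w v = 0"
      using l2.Cauchy_Schwarz[OF approx_L2[OF W] approx_L2[OF V]] w
        l2_norm_eq_0_iff[OF approx_L2[OF W]] by simp
    then show ?thesis using l2_inner_approx_tendsto[OF W V] by simp
  qed
  ultimately have "(\<lambda>n. (C + 1) * l2_inner m (W n) (V n) - P (W n) (V n)) \<longlonglongrightarrow> (C + 1) * 0 - 0"
    by (intro tendsto_intros)
  then show ?thesis by (simp add: Q_eq_P)
qed

text \<open>The differences of two approximating sequences of one element approximate 0, so
  closability removes their contribution. This makes the \<open>THE\<close> in
  \<open>form_closure\<close> meaningful.\<close>

lemma approx_Q_limit_unique:
  assumes U: "approx U u" "approx U' u" and V: "approx V v" and W: "approx V' v"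
    and lim: "(\<lambda>n. Q (U n) (V n)) \<longlonglongrightarrow> c"
  shows "(\<lambda>n. Q (U' n) (V' n)) \<longlonglongrightarrow> c"
proof -
  note D = approx_D[OF U(1)] approx_D[OF U(2)] approx_D[OF V] approx_D[OF W]
  have a: "(\<lambda>n. Q (\<lambda>x. U' n x - U n x) (V' n)) \<longlonglongrightarrow> 0"
    by (rule approx_zero_Q_tendsto[OF approx_diff[OF U(2,1)] _ W]) simp
  have b: "(\<lambda>n. Q (\<lambda>x. V' n x - V n x) (U n)) \<longlonglongrightarrow> 0"
    by (rule approx_zero_Q_tendsto[OF approx_diff[OF W V] _ U(1)]) simp
  have eq: "Q (U' n) (V' n) = Q (U n) (V n) + Q (\<lambda>x. U' n x - U n x) (V' n)
      + Q (\<lambda>x. V' n x - V n x) (U n)" for n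
  proof -
    have "Q (\<lambda>x. U' n x - U n x) (V' n) = Q (U' n) (V' n) - Q (U n) (V' n)"
      using Q_add[OF P.diff_mem[OF D(2)[of n] D(1)[of n]] D(1)[of n] D_L2[OF D(4)[of n]]] by simp
    moreover have "Q (\<lambda>x. V' n x - V n x) (U n) = Q (V' n) (U n) - Q (V n) (U n)"
      using Q_add[OF P.diff_mem[OF D(4)[of n] D(3)[of n]] D(3)[of n] D_L2[OF D(1)[of n]]] by simp
    moreover have "Q (V' n) (U n) = Q (U n) (V' n)" "Q (V n) (U n) = Q (U n) (V n)"
      using D Q_commute by auto
    ultimately show ?thesis by simp
  qed
  show ?thesis unfolding eq using tendsto_add[OF tendsto_add[OF lim a] b] by simp
qed

lemma form_closure_tendsto:
  assumes U: "approx U u" and V: "approx V v"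
  shows "(\<lambda>n. Q (U n) (V n)) \<longlonglongrightarrow> q u v"
proof -
  obtain c where c: "(\<lambda>n. Q (U n) (V n)) \<longlonglongrightarrow> c"
    using approx_convergent[OF U V] by (auto simp: convergent_def)
  have "\<forall>U V. approx U u \<longrightarrow> approx V v \<longrightarrow> (\<lambda>n. Q (U n) (V n)) \<longlonglongrightarrow> q u v"
    unfolding form_closure_def
  proof (rule theI)
    show "\<forall>U V. approx U u \<longrightarrow> approx V v \<longrightarrow> (\<lambda>n. Q (U n) (V n)) \<longlonglongrightarrow> c"
      using approx_Q_limit_unique[OF U _ V _ c] by blast
    show "c' = c"
      if "\<forall>U V. approx U u \<longrightarrow> approx V v \<longrightarrow> (\<lambda>n. Q (U n) (V n)) \<longlonglongrightarrow> c'" for c'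
      using that U V c LIMSEQ_unique by blast
  qed
  then show ?thesis using U V by blast
qed

lemma form_closure_eqI:
  "approx U u \<Longrightarrow> approx V v \<Longrightarrow> (\<lambda>n. Q (U n) (V n)) \<longlonglongrightarrow> c \<Longrightarrow> q u v = c"
  using form_closure_tendsto LIMSEQ_unique by blast

section \<open>The closed form and the operator associated with it\<close>

lemma FE: assumes "u \<in> F" obtains U where "approx U u"
  using assms by (auto simp: form_closure_domain_def)

lemma FI: "approx U u \<Longrightarrow> u \<in> F"
  by (auto simp: form_closure_domain_def)

lemma F_L2: "u \<in> F \<Longrightarrow> u \<in> L2 m"
  by (auto elim: FE intro: approx_L2)

lemma D_subset_F: "D \<subseteq> F"
  using approx_const FI by blast

lemma F_dense: "l2_dense m F"
  using dense D_subset_F F_L2 unfolding l2_dense_def by (meson in_mono subsetI)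

lemma q_commute: assumes "u \<in> F" "v \<in> F" shows "q u v = q v u"
proof -
  from assms obtain U V where UV: "approx U u" "approx V v" by (metis FE)
  show ?thesis
    using form_closure_tendsto[OF UV(2,1)] Q_commute[OF approx_D[OF UV(2)] approx_D[OF UV(1)]]
    by (intro form_closure_eqI[OF UV]) simp
qed

lemma q_add:
  assumes "u \<in> F" "v \<in> F" "w \<in> F"
  shows "q (\<lambda>x. u x + v x) w = q u w + q v w"
proof -
  from assms obtain U V W where *: "approx U u" "approx V v" "approx W w" by (metis FE)
  show ?thesis
    using tendsto_add[OF form_closure_tendsto[OF *(1,3)] form_closure_tendsto[OF *(2,3)]]
      Q_add[OF approx_D[OF *(1)] approx_D[OF *(2)] D_L2[OF approx_D[OF *(3)]]]
    by (intro form_closure_eqI[OF approx_add[OF *(1,2)] *(3)]) simp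
qed

lemma q_scale:
  assumes "u \<in> F" "w \<in> F"
  shows "q (\<lambda>x. c * u x) w = c * q u w"
proof -
  from assms obtain U W where *: "approx U u" "approx W w" by (metis FE)
  show ?thesis
    using tendsto_mult[OF tendsto_const form_closure_tendsto[OF *], of c]
      Q_scale[OF approx_D[OF *(1)] D_L2[OF approx_D[OF *(2)]]]
    by (intro form_closure_eqI[OF approx_scale[OF *(1)] *(2)]) simp
qed

text \<open>An element of the original domain is approximated by a constant sequence, so only the
  second argument moves and L2 convergence is enough. This gives the extension property.\<close>

lemma q_eq:
  assumes uw: "(u, w) \<in> G" and "v \<in> F"
  shows "q u v = l2_inner m w v"
proof -
  from assms obtain V where V: "approx V v" by (metis FE)
  note L = graph_L2[OF uw]
  have "(\<lambda>n. l2_inner m w (V n)) \<longlonglongrightarrow> l2_inner m w v"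
    by (rule l2.B_tendsto)
       (use L V approx_D[OF V, THEN D_L2] approx_L2[OF V] approx_tendsto[OF V] in
         \<open>auto simp: l2_norm_def l2_inner_def\<close>)
  then show ?thesis
    using Q_eq[OF uw D_L2[OF approx_D[OF V]]] uw
    by (intro form_closure_eqI[OF approx_const V]) auto
qed

text \<open>The limit enters \<open>form_approx\<close> only through its membership in L2 and an L2
  distance. The lemma provides the closure of the Friedrichs graph under change of
  representatives.\<close>

lemma approx_cong_AE:
  assumes u: "u \<in> L2 m" and u': "u' \<in> borel_measurable m" and eq: "AE x in m. u' x = u x"
  shows "approx U u' \<longleftrightarrow> approx U u"
proof -
  have u'L: "u' \<in> L2 m" by (rule L2_cong_AE[OF u u' eq])
  have "l2_norm m (\<lambda>x. U n x - u' x) = l2_norm m (\<lambda>x. U n x - u x)" if "range U \<subseteq> D" for n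
  proof (rule l2_norm_cong_AE)
    have "U n \<in> L2 m" using that D_L2 by blast
    then show "(\<lambda>x. U n x - u' x) \<in> borel_measurable m" "(\<lambda>x. U n x - u x) \<in> borel_measurable m"
      using u u'L by (auto dest!: L2_measurable)
    show "AE x in m. U n x - u' x = U n x - u x" using eq by eventually_elim simp
  qed
  then show ?thesis using u u'L unfolding form_approx_def by auto
qed

lemma friedrichs_iff:
  "(u, w) \<in> friedrichs_extension m G \<longleftrightarrow>
     u \<in> F \<and> w \<in> L2 m \<and> (\<forall>v\<in>F. q u v = l2_inner m w v)"
  by (simp add: friedrichs_extension_def form_operator_def)

lemma friedrichs_extends: "G \<subseteq> friedrichs_extension m G"
  using D_subset_F graph_L2 q_eq by (auto simp: friedrichs_iff)

lemma friedrichs_operator: "l2_operator m (friedrichs_extension m G)" (is "l2_operator m ?A")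
  unfolding l2_operator_def
proof (intro conjI)
  show "?A \<subseteq> L2 m \<times> L2 m" using F_L2 by (auto simp: friedrichs_iff)
  show "\<forall>(u, v)\<in>?A. \<forall>u'\<in>borel_measurable m. \<forall>v'\<in>borel_measurable m.
      (AE x in m. u' x = u x) \<longrightarrow> (AE x in m. v' x = v x) \<longrightarrow> (u', v') \<in> ?A"
  proof (clarify)
    fix u v u' v'
    assume uv: "(u, v) \<in> ?A" and u': "u' \<in> borel_measurable m" "AE x in m. u' x = u x"
      and v': "v' \<in> borel_measurable m" "AE x in m. v' x = v x"
    have u: "u \<in> F" and v: "v \<in> L2 m" and quv: "\<And>w. w \<in> F \<Longrightarrow> q u w = l2_inner m v w"
      using uv by (auto simp: friedrichs_iff)
    \<comment> \<open>Both representatives have the very same approximating sequences, so membership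
      in \<open>F\<close> and the value of \<open>q\<close> carry over by rewriting the
      definitions.\<close>
    have iff: "approx U u' \<longleftrightarrow> approx U u" for U
      by (rule approx_cong_AE[OF F_L2[OF u] u'])
    have "u' \<in> F" using u by (simp add: form_closure_domain_def iff)
    moreover have "v' \<in> L2 m" by (rule L2_cong_AE[OF v v'])
    moreover have "q u' w = l2_inner m v' w" if w: "w \<in> F" for w
    proof -
      have "q u' w = q u w" unfolding form_closure_def iff ..
      also have "\<dots> = l2_inner m v w" by (rule quv[OF w])
      also have "\<dots> = l2_inner m v' w"
        using v v' F_L2[OF w] by (intro l2_inner_cong_AE) (auto dest: L2_measurable)
      finally show ?thesis .
    qed
    ultimately show "(u', v') \<in> ?A" by (simp add: friedrichs_iff)
  qed
  show "\<forall>u v v'. (u, v) \<in> ?A \<longrightarrow> (u, v') \<in> ?A \<longrightarrow> (AE x in m. v x = v' x)"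
  proof (intro allI impI)
    fix u v v' assume "(u, v) \<in> ?A" "(u, v') \<in> ?A"
    then show "AE x in m. v x = v' x"
      by (intro AE_eq_if_inner_eq_on_dense[OF F_dense]) (auto simp: friedrichs_iff)
  qed
  show "((\<lambda>_. 0), (\<lambda>_. 0)) \<in> ?A"
    using friedrichs_extends l2_operatorD(6)[OF operator] by blast
  show "\<forall>(u, v)\<in>?A. \<forall>(u', v')\<in>?A. ((\<lambda>x. u x + u' x), (\<lambda>x. v x + v' x)) \<in> ?A"
  proof (clarify)
    fix u v u' v' assume "(u, v) \<in> ?A" "(u', v') \<in> ?A"
    then have *: "u \<in> F" "v \<in> L2 m" "\<And>w. w \<in> F \<Longrightarrow> q u w = l2_inner m v w"
        "u' \<in> F" "v' \<in> L2 m" "\<And>w. w \<in> F \<Longrightarrow> q u' w = l2_inner m v' w"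
      by (auto simp: friedrichs_iff)
    have "(\<lambda>x. u x + u' x) \<in> F" using *(1,4) by (metis FE FI approx_add)
    then show "((\<lambda>x. u x + u' x), (\<lambda>x. v x + v' x)) \<in> ?A"
      using * by (simp add: friedrichs_iff L2_add q_add l2.add_left F_L2)
  qed
  show "\<forall>c::real. \<forall>(u, v)\<in>?A. ((\<lambda>x. c * u x), (\<lambda>x. c * v x)) \<in> ?A"
  proof (clarify)
    fix c u v assume "(u, v) \<in> ?A"
    then have *: "u \<in> F" "v \<in> L2 m" "\<And>w. w \<in> F \<Longrightarrow> q u w = l2_inner m v w"
      by (auto simp: friedrichs_iff)
    have "(\<lambda>x. c * u x) \<in> F" using *(1) by (metis FE FI approx_scale)
    then show "((\<lambda>x. c * u x), (\<lambda>x. c * v x)) \<in> ?A"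
      using * by (simp add: friedrichs_iff L2_scale q_scale l2.scale_left F_L2)
  qed
qed

lemma friedrichs_symmetric: "l2_symmetric m (friedrichs_extension m G)"
  unfolding l2_symmetric_def
proof
  fix p assume p: "p \<in> friedrichs_extension m G"
  obtain v w where vw: "p = (v, w)" by (cases p)
  have v: "v \<in> F" "w \<in> L2 m" "\<And>u. u \<in> F \<Longrightarrow> q v u = l2_inner m w u"
    using p by (auto simp: vw friedrichs_iff)
  have "l2_inner m u' v = l2_inner m u w" if "(u, u') \<in> friedrichs_extension m G" for u u'
  proof -
    have u: "u \<in> F" "u' \<in> L2 m" "q u v = l2_inner m u' v"
      using that v by (auto simp: friedrichs_iff)
    show ?thesis
      using q_commute[OF u(1) v(1)] u(3) v(3)[OF u(1)] l2.commute[OF v(2) F_L2[OF u(1)]] by simp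
  qed
  then show "p \<in> l2_adjoint m (friedrichs_extension m G)"
    using v F_L2 by (auto simp: vw l2_adjoint_def)
qed

end

section \<open>Symmetric sub-Markovian semigroups\<close>

locale l2_semigroup =
  fixes m :: "'a measure" and S :: "real \<Rightarrow> ('a \<Rightarrow> real) \<Rightarrow> ('a \<Rightarrow> real)"
  assumes scs: "strongly_continuous_semigroup m S"
begin

abbreviation "L \<equiv> semigroup_generator m S"

lemma S_bl: "t \<ge> 0 \<Longrightarrow> l2_bounded_linear m (S t)"
  using scs by (simp add: strongly_continuous_semigroup_def)

lemma S_L2: "t \<ge> 0 \<Longrightarrow> u \<in> L2 m \<Longrightarrow> S t u \<in> L2 m"
  using S_bl[of t] by (auto simp: l2_bounded_linear_def)

lemma S_add: "t \<ge> 0 \<Longrightarrow> u \<in> L2 m \<Longrightarrow> v \<in> L2 m \<Longrightarrow>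
    AE x in m. S t (\<lambda>y. u y + v y) x = S t u x + S t v x"
  using S_bl[of t] by (simp add: l2_bounded_linear_def)

lemma S_scale: "t \<ge> 0 \<Longrightarrow> u \<in> L2 m \<Longrightarrow> AE x in m. S t (\<lambda>y. c * u y) x = c * S t u x"
  using S_bl[of t] by (simp add: l2_bounded_linear_def)

lemma S_bound: "t \<ge> 0 \<Longrightarrow> \<exists>C. \<forall>u\<in>L2 m. l2_norm m (S t u) \<le> C * l2_norm m u"
  using S_bl[of t] by (simp add: l2_bounded_linear_def)

lemma S_zero: "u \<in> L2 m \<Longrightarrow> AE x in m. S 0 u x = u x"
  using scs by (simp add: strongly_continuous_semigroup_def)

lemma S_semigroup: "s \<ge> 0 \<Longrightarrow> t \<ge> 0 \<Longrightarrow> u \<in> L2 m \<Longrightarrow> AE x in m. S (s + t) u x = S s (S t u) x"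
  using scs by (simp add: strongly_continuous_semigroup_def)

lemma S_tendsto: "u \<in> L2 m \<Longrightarrow> t \<ge> 0 \<Longrightarrow>
    ((\<lambda>s. l2_norm m (\<lambda>x. S s u x - S t u x)) \<longlongrightarrow> 0) (at t within {0..})"
  using scs by (simp add: strongly_continuous_semigroup_def)

lemma S_diff:
  assumes "t \<ge> 0" "u \<in> L2 m" "v \<in> L2 m"
  shows "AE x in m. S t (\<lambda>y. u y - v y) x = S t u x - S t v x"
  using S_add[OF assms(1,2) l2.minus_mem[OF assms(3)]] S_scale[OF assms(1,3), of "-1"]
  by eventually_elim simp

lemma inner_S_continuous:
  assumes "u \<in> L2 m" "w \<in> L2 m"
  shows "continuous_on {0..} (\<lambda>t. l2_inner m (S t u) w)"
  unfolding continuous_on_def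
proof
  fix t :: real assume "t \<in> {0..}"
  then have t: "t \<ge> 0" by simp
  show "((\<lambda>t. l2_inner m (S t u) w) \<longlongrightarrow> l2_inner m (S t u) w) (at t within {0..})"
    by (rule l2.B_tendsto)
       (use assms t S_L2 S_tendsto[OF assms(1) t] in
         \<open>auto simp: eventually_at_filter l2_norm_def l2_inner_def\<close>)
qed

text \<open>By the semigroup law and linearity the error at time \<open>t\<close> is
  \<open>S t\<close> applied to the error at time 0, so the bound of this single operator
  suffices.\<close>

lemma generator_right_difference:
  assumes uv: "(u, v) \<in> L" and t: "t \<ge> 0"
  shows "((\<lambda>h. l2_norm m (\<lambda>x. (S (t + h) u x - S t u x) / h - S t v x)) \<longlongrightarrow> 0) (at_right 0)"
proof -
  have u: "u \<in> L2 m" and v: "v \<in> L2 m"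
    and lim: "((\<lambda>h. l2_norm m (\<lambda>x. (S h u x - u x) / h - v x)) \<longlongrightarrow> 0) (at_right 0)"
    using uv by (auto simp: semigroup_generator_def)
  obtain C where C: "\<And>u. u \<in> L2 m \<Longrightarrow> l2_norm m (S t u) \<le> C * l2_norm m u"
    using S_bound[OF t] by blast
  show ?thesis
  proof (rule Lim_null_comparison)
    show "((\<lambda>h. C * l2_norm m (\<lambda>x. (S h u x - u x) / h - v x)) \<longlongrightarrow> 0) (at_right 0)"
      by (rule tendsto_mult_right_zero[OF lim])
    show "\<forall>\<^sub>F h in at_right 0. norm (l2_norm m (\<lambda>x. (S (t + h) u x - S t u x) / h - S t v x))
        \<le> C * l2_norm m (\<lambda>x. (S h u x - u x) / h - v x)"
      using eventually_at_right_less[of "0::real"]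
    proof eventually_elim
      case (elim h)
      then have h: "h \<ge> 0" by simp
      define z where "z = (\<lambda>x. (S h u x - u x) / h)"
      have z: "z \<in> L2 m" "(\<lambda>x. z x - v x) \<in> L2 m"
        unfolding z_def by (intro l2.divide_mem l2.diff_mem S_L2 h u v)+
      have "AE x in m. (S (t + h) u x - S t u x) / h - S t v x = S t (\<lambda>x. z x - v x) x"
        using S_semigroup[OF t h u] S_diff[OF t S_L2[OF h u] u] S_diff[OF t z(1) v]
          S_scale[OF t l2.diff_mem[OF S_L2[OF h u] u], of "inverse h"]
        by eventually_elim (simp add: z_def field_simps)
      moreover have "(\<lambda>x. (S (t + h) u x - S t u x) / h - S t v x) \<in> L2 m"
        by (intro l2.diff_mem l2.divide_mem S_L2 u v t add_nonneg_nonneg h)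
      ultimately have "l2_norm m (\<lambda>x. (S (t + h) u x - S t u x) / h - S t v x)
          = l2_norm m (S t (\<lambda>x. z x - v x))"
        by (intro l2_norm_cong_AE) (auto intro: L2_measurable S_L2 t z(2))
      also have "\<dots> \<le> C * l2_norm m (\<lambda>x. z x - v x)" by (rule C[OF z(2)])
      finally show ?case by (simp add: z_def)
    qed
  qed
qed

text \<open>The same quotient as before, with \<open>S (t + h) u\<close> read as
  \<open>S h (S t u)\<close>. It allows the symmetry of the generator to be applied along
  orbits.\<close>

lemma generator_invariant:
  assumes uv: "(u, v) \<in> L" and t: "t \<ge> 0"
  shows "(S t u, S t v) \<in> L"
proof -
  have u: "u \<in> L2 m" and v: "v \<in> L2 m"
    using uv by (auto simp: semigroup_generator_def)
  have "((\<lambda>h. l2_norm m (\<lambda>x. (S h (S t u) x - S t u x) / h - S t v x)) \<longlongrightarrow> 0) (at_right 0)"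
  proof (rule Lim_transform_eventually[OF generator_right_difference[OF uv t]])
    show "\<forall>\<^sub>F h in at_right 0. l2_norm m (\<lambda>x. (S (t + h) u x - S t u x) / h - S t v x)
        = l2_norm m (\<lambda>x. (S h (S t u) x - S t u x) / h - S t v x)"
      using eventually_at_right_less[of "0::real"]
    proof eventually_elim
      case (elim h)
      then have h: "h \<ge> 0" by simp
      show ?case
      proof (rule l2_norm_cong_AE)
        show "AE x in m. (S (t + h) u x - S t u x) / h - S t v x
            = (S h (S t u) x - S t u x) / h - S t v x"
          using S_semigroup[OF h t u] by eventually_elim (simp add: add.commute)
      qed (intro L2_measurable l2.diff_mem l2.divide_mem S_L2 u v t add_nonneg_nonneg h)+
    qed
  qed
  then show ?thesis
    using u v t by (simp add: semigroup_generator_def S_L2)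
qed

text \<open>Pairing with \<open>w\<close> makes both the orbit and its candidate derivative
  continuous real functions, so the right derivative becomes two-sided in the interior.\<close>

lemma inner_S_derivative:
  assumes uv: "(u, v) \<in> L" and w: "w \<in> L2 m" and t: "t \<ge> 0"
  shows "((\<lambda>t. l2_inner m (S t u) w) has_real_derivative l2_inner m (S t v) w) (at t within {0..})"
proof -
  have u: "u \<in> L2 m" and v: "v \<in> L2 m"
    using uv by (auto simp: semigroup_generator_def)
  show ?thesis
  proof (rule has_derivative_of_continuous_right_derivative[OF _ _ _ t])
    fix t :: real assume t: "t \<ge> 0"
    have "((\<lambda>h. l2_inner m (\<lambda>x. (S (t + h) u x - S t u x) / h) w) \<longlongrightarrow> l2_inner m (S t v) w) (at_right 0)"
    proof (rule l2.B_tendsto)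
      show "\<forall>\<^sub>F h in at_right 0. (\<lambda>x. (S (t + h) u x - S t u x) / h) \<in> L2 m"
        using eventually_at_right_less[of "0::real"]
        by eventually_elim (intro l2.divide_mem l2.diff_mem S_L2 u; use t in simp)
    qed (use generator_right_difference[OF uv t] w S_L2[OF t v] in
          \<open>auto simp: l2_norm_def l2_inner_def\<close>)
    moreover have "\<forall>\<^sub>F h in at_right 0. l2_inner m (\<lambda>x. (S (t + h) u x - S t u x) / h) w
        = (l2_inner m (S (t + h) u) w - l2_inner m (S t u) w) / h"
      using eventually_at_right_less[of "0::real"]
    proof eventually_elim
      case (elim h)
      then have "t + h \<ge> 0" using t by simp
      note L = S_L2[OF this u] S_L2[OF t u]
      show ?case
        using l2.divide_left[OF l2.diff_mem[OF L] w, of h] l2.diff_left[OF L w] by simp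
    qed
    ultimately have "((\<lambda>h. (l2_inner m (S (t + h) u) w - l2_inner m (S t u) w) / h)
        \<longlongrightarrow> l2_inner m (S t v) w) (at_right 0)"
      by (rule Lim_transform_eventually)
    then show "((\<lambda>t. l2_inner m (S t u) w) has_real_derivative l2_inner m (S t v) w) (at_right t)"
      by (simp add: has_real_derivative_at_right_iff)
  qed (intro inner_S_continuous u v w)+
qed

lemma inner_S_constant:
  assumes uu': "(u, u') \<in> L" and ww': "(w, w') \<in> L" and sym: "l2_symmetric m L" and t: "t \<ge> 0"
  shows "l2_inner m (S t u) (S 0 w) = l2_inner m (S 0 u) (S t w)"
proof -
  have L2: "u \<in> L2 m" "u' \<in> L2 m" "w \<in> L2 m" "w' \<in> L2 m"
    using uu' ww' by (auto simp: semigroup_generator_def)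
  define f where "f s = l2_inner m (S s u) (S (t - s) w)" for s
  have tendsto_w: "((\<lambda>s. l2_norm m (\<lambda>x. S (t - s) w x - S (t - r) w x)) \<longlongrightarrow> 0) (at r within {0..t})"
    if r: "r \<in> {0..t}" for r
  proof (rule filterlim_compose[OF S_tendsto[OF L2(3)]])
    show "t - r \<ge> 0" using r by simp
    have "((\<lambda>s. t - s) \<longlongrightarrow> t - r) (at r within {0..t})" by (intro tendsto_intros)
    then show "filterlim (\<lambda>s. t - s) (at (t - r) within {0..}) (at r within {0..t})"
      unfolding filterlim_at by (auto simp: eventually_at_filter)
  qed
  have "f t = f 0"
  proof (rule constant_of_zero_right_derivative[OF t])
    show "continuous_on {0..t} f"
      unfolding continuous_on_def
    proof
      fix r assume r: "r \<in> {0..t}"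
      have "((\<lambda>s. l2_norm m (\<lambda>x. S s u x - S r u x)) \<longlongrightarrow> 0) (at r within {0..t})"
        by (rule tendsto_within_subset[OF S_tendsto[OF L2(1)]]) (use r in auto)
      then show "(f \<longlongrightarrow> f r) (at r within {0..t})"
        unfolding f_def
        by (intro l2.B_tendsto)
           (use r S_L2 L2 tendsto_w[OF r] in \<open>auto simp: eventually_at_filter\<close>)
    qed
  next
    fix s assume s: "0 \<le> s" "s < t"
    have at: "at s within {s<..<t} = at_right s" using s by (intro at_within_nhd[of s "{..<t}"]) auto
    have pos: "\<forall>\<^sub>F h in at_right 0. h > 0 \<and> s + h < t"
      using s by (auto simp: eventually_at_right[of 0 "t - s"] intro!: exI[of _ "t - s"])
    have "((\<lambda>r. l2_norm m (\<lambda>x. S (t - r) w x - S (t - s) w x)) \<longlongrightarrow> 0) (at_right s)"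
      unfolding at[symmetric] by (rule tendsto_within_subset[OF tendsto_w]) (use s in auto)
    then have tw: "((\<lambda>h. l2_norm m (\<lambda>x. S (t - (s + h)) w x - S (t - s) w x)) \<longlongrightarrow> 0) (at_right 0)"
      unfolding at_right_to_0[of s] by (simp add: filterlim_filtermap add.commute)
    \<comment> \<open>The quotient converges in norm, so it may be paired with the moving second
      factor.\<close>
    have 1: "((\<lambda>h. l2_inner m (\<lambda>x. (S (s + h) u x - S s u x) / h) (S (t - (s + h)) w))
        \<longlongrightarrow> l2_inner m (S s u') (S (t - s) w)) (at_right 0)"
    proof (rule l2.B_tendsto)
      show "\<forall>\<^sub>F h in at_right 0. (\<lambda>x. (S (s + h) u x - S s u x) / h) \<in> L2 m"
        using pos by eventually_elim (intro l2.divide_mem l2.diff_mem S_L2 L2; use s in simp)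
      show "\<forall>\<^sub>F h in at_right 0. S (t - (s + h)) w \<in> L2 m"
        using pos by eventually_elim (intro S_L2 L2; use s in simp)
    qed (use S_L2 L2 s tw generator_right_difference[OF uu' s(1)] in auto)
    \<comment> \<open>As \<open>r\<close> increases, \<open>t - r\<close> decreases: here the left
      derivative of an orbit at \<open>t - s\<close> enters, which \<open>inner_S_derivative\<close>
      provides.\<close>
    have "((\<lambda>r. l2_inner m (S (t - r) w) (S s u)) has_real_derivative
        l2_inner m (S (t - s) w') (S s u) * (- 1)) (at s within {s<..<t})"
    proof -
      have "((\<lambda>r. l2_inner m (S r w) (S s u)) has_real_derivative
          l2_inner m (S (t - s) w') (S s u)) (at (t - s) within (\<lambda>r. t - r) ` {s<..<t})"
        by (rule has_field_derivative_subset[OF inner_S_derivative[OF ww' S_L2[OF s(1) L2(1)]]])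
           (use s in auto)
      moreover have "((\<lambda>r. t - r) has_real_derivative - 1) (at s within {s<..<t})"
        by (auto intro!: derivative_eq_intros)
      ultimately show ?thesis
        using DERIV_image_chain[of "\<lambda>r. l2_inner m (S r w) (S s u)" _ "\<lambda>r. t - r" s "{s<..<t}"]
        unfolding o_def by blast
    qed
    then have 2: "((\<lambda>h. (l2_inner m (S (t - (s + h)) w) (S s u) - l2_inner m (S (t - s) w) (S s u)) / h)
        \<longlongrightarrow> - l2_inner m (S (t - s) w') (S s u)) (at_right 0)"
      unfolding at by (simp add: has_real_derivative_at_right_iff)
    have "l2_inner m (S s u') (S (t - s) w) = l2_inner m (S s u) (S (t - s) w')"
      using sym generator_invariant[OF uu' s(1)] generator_invariant[OF ww', of "t - s"] s
      by (auto simp: l2_symmetric_def l2_adjoint_def)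
    also have "\<dots> = l2_inner m (S (t - s) w') (S s u)"
      by (rule l2.commute) (use S_L2 L2 s in auto)
    finally have "((\<lambda>h. l2_inner m (\<lambda>x. (S (s + h) u x - S s u x) / h) (S (t - (s + h)) w) +
        (l2_inner m (S (t - (s + h)) w) (S s u) - l2_inner m (S (t - s) w) (S s u)) / h)
        \<longlongrightarrow> 0) (at_right 0)"
      using tendsto_add[OF 1 2] by simp
    moreover have "\<forall>\<^sub>F h in at_right 0.
        l2_inner m (\<lambda>x. (S (s + h) u x - S s u x) / h) (S (t - (s + h)) w) +
        (l2_inner m (S (t - (s + h)) w) (S s u) - l2_inner m (S (t - s) w) (S s u)) / h
        = (f (s + h) - f s) / h"
      using pos
    proof eventually_elim
      case (elim h)
      then have nn: "0 \<le> s + h" "0 \<le> t - (s + h)" "0 \<le> t - s" using s by auto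
      note a = S_L2[OF nn(1) L2(1)] and b = S_L2[OF s(1) L2(1)]
        and c = S_L2[OF nn(2) L2(3)] and d = S_L2[OF nn(3) L2(3)]
      have "l2_inner m (\<lambda>x. (S (s + h) u x - S s u x) / h) (S (t - (s + h)) w)
          = (f (s + h) - l2_inner m (S s u) (S (t - (s + h)) w)) / h"
        using l2.divide_left[OF l2.diff_mem[OF a b] c] l2.diff_left[OF a b c] by (simp add: f_def)
      then show ?case
        using l2.commute[OF b c] l2.commute[OF b d] by (simp add: f_def flip: add_divide_distrib)
    qed
    ultimately have "((\<lambda>h. (f (s + h) - f s) / h) \<longlongrightarrow> 0) (at_right 0)"
      by (rule Lim_transform_eventually)
    then show "(f has_real_derivative 0) (at_right s)"
      by (simp add: has_real_derivative_at_right_iff)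
  qed
  then show ?thesis by (simp add: f_def)
qed

text \<open>The identity holds on the dense domain, and both sides depend continuously on
  \<open>u\<close> and \<open>w\<close> because \<open>S t\<close> is bounded.\<close>

lemma S_symmetric:
  assumes dense: "l2_dense m (Domain L)" and sym: "l2_symmetric m L"
    and t: "t \<ge> 0" and u: "u \<in> L2 m" and w: "w \<in> L2 m"
  shows "l2_inner m (S t u) w = l2_inner m u (S t w)"
proof -
  have dom: "l2_inner m (S t u) w = l2_inner m u (S t w)" if "u \<in> Domain L" "w \<in> Domain L" for u w
  proof -
    from that obtain u' w' where *: "(u, u') \<in> L" "(w, w') \<in> L" by blast
    have L2: "u \<in> L2 m" "w \<in> L2 m"
      using * by (auto simp: semigroup_generator_def)
    have "l2_inner m (S t u) w = l2_inner m (S t u) (S 0 w)"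
      using S_zero[OF L2(2)] by (intro l2_inner_cong_AE) (auto intro!: L2_measurable S_L2 L2 t)
    also have "\<dots> = l2_inner m (S 0 u) (S t w)"
      by (rule inner_S_constant[OF * sym t])
    also have "\<dots> = l2_inner m u (S t w)"
      using S_zero[OF L2(1)] by (intro l2_inner_cong_AE) (auto intro!: L2_measurable S_L2 L2 t)
    finally show ?thesis .
  qed
  have seq: "\<exists>V. (\<forall>n. V n \<in> Domain L) \<and> (\<lambda>n. l2_norm m (\<lambda>x. V n x - v x)) \<longlonglongrightarrow> 0 \<and>
      (\<lambda>n. l2_norm m (\<lambda>x. S t (V n) x - S t v x)) \<longlonglongrightarrow> 0" if v: "v \<in> L2 m" for v
  proof -
    have "\<exists>z\<in>Domain L. l2_norm m (\<lambda>x. v x - z x) < inverse (real (Suc n))" for n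
      using dense v unfolding l2_dense_def by simp
    then obtain V where V: "\<And>n. V n \<in> Domain L"
        "\<And>n. l2_norm m (\<lambda>x. v x - V n x) < inverse (real (Suc n))" by metis
    have VL: "V n \<in> L2 m" for n using V(1)[of n] dense by (auto simp: l2_dense_def)
    have lim: "(\<lambda>n. l2_norm m (\<lambda>x. V n x - v x)) \<longlonglongrightarrow> 0"
    proof (rule Lim_null_comparison[OF _ LIMSEQ_inverse_real_of_nat])
      show "\<forall>\<^sub>F n in sequentially. norm (l2_norm m (\<lambda>x. V n x - v x)) \<le> inverse (real (Suc n))"
        using V(2) l2.N_minus_commute[OF v VL] by (simp add: less_imp_le)
    qed
    obtain C where C: "\<And>u. u \<in> L2 m \<Longrightarrow> l2_norm m (S t u) \<le> C * l2_norm m u"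
      using S_bound[OF t] by blast
    have "l2_norm m (\<lambda>x. S t (V n) x - S t v x) \<le> C * l2_norm m (\<lambda>x. V n x - v x)" for n
    proof -
      have "l2_norm m (\<lambda>x. S t (V n) x - S t v x) = l2_norm m (S t (\<lambda>x. V n x - v x))"
        using S_diff[OF t VL[of n] v]
        by (intro l2_norm_cong_AE L2_measurable l2.diff_mem S_L2 t VL v) auto
      then show ?thesis using C[OF l2.diff_mem[OF VL v]] by simp
    qed
    then have "(\<lambda>n. l2_norm m (\<lambda>x. S t (V n) x - S t v x)) \<longlonglongrightarrow> 0"
      by (intro Lim_null_comparison[OF _ tendsto_mult_right_zero[OF lim, of C]]) simp
    with V(1) lim show ?thesis by blast
  qed
  obtain U W where U: "\<And>n. U n \<in> Domain L" "(\<lambda>n. l2_norm m (\<lambda>x. U n x - u x)) \<longlonglongrightarrow> 0"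
      "(\<lambda>n. l2_norm m (\<lambda>x. S t (U n) x - S t u x)) \<longlonglongrightarrow> 0"
    using seq[OF u] by blast
  obtain W where W: "\<And>n. W n \<in> Domain L" "(\<lambda>n. l2_norm m (\<lambda>x. W n x - w x)) \<longlonglongrightarrow> 0"
      "(\<lambda>n. l2_norm m (\<lambda>x. S t (W n) x - S t w x)) \<longlonglongrightarrow> 0"
    using seq[OF w] by blast
  have L2: "U n \<in> L2 m" "W n \<in> L2 m" for n
    using U(1) W(1) dense by (auto simp: l2_dense_def)
  have "(\<lambda>n. l2_inner m (S t (U n)) (W n)) \<longlonglongrightarrow> l2_inner m (S t u) w"
    by (rule l2.B_tendsto) (use L2 u w U W S_L2[OF t] in auto)
  moreover have "(\<lambda>n. l2_inner m (U n) (S t (W n))) \<longlonglongrightarrow> l2_inner m u (S t w)"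
    by (rule l2.B_tendsto) (use L2 u w U W S_L2[OF t] in auto)
  ultimately show ?thesis
    using dom[OF U(1) W(1)] LIMSEQ_unique by simp
qed

end

section \<open>Semigroup orbits as solutions of the equations\<close>

lemma bounded_densities_L2:
  assumes u: "u \<in> bounded_densities m"
  shows "u \<in> L2 m"
proof -
  obtain C where C: "AE x in m. \<bar>u x\<bar> \<le> C" and int: "integrable m u"
    using u by (auto simp: bounded_densities_def)
  have "integrable m (\<lambda>x. (u x)\<^sup>2)"
  proof (rule Bochner_Integration.integrable_bound)
    show "integrable m (\<lambda>x. C * u x)" using int by simp
    show "AE x in m. norm ((u x)\<^sup>2) \<le> norm (C * u x)"
      using C
    proof eventually_elim
      case (elim x)
      then have "\<bar>u x\<bar> * \<bar>u x\<bar> \<le> \<bar>C\<bar> * \<bar>u x\<bar>"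
        by (intro mult_right_mono) auto
      then show ?case by (simp add: power2_eq_square abs_mult)
    qed
  qed (use int in auto)
  then show ?thesis using int by (simp add: L2_def)
qed

lemma normalized_indicator_bounded_density:
  assumes A: "A \<in> sets m" "emeasure m A < \<infinity>" "measure m A \<noteq> 0"
  shows "(\<lambda>x. indicator A x / measure m A) \<in> bounded_densities m"
proof -
  have "\<bar>indicator A x / measure m A\<bar> \<le> 1 / measure m A" for x
    by (auto simp: indicator_def)
  then show ?thesis
    using A unfolding bounded_densities_def
    by (auto intro!: exI[of _ "1 / measure m A"] integrable_real_indicator)
qed

locale symmetric_sub_Markovian_semigroup = l2_semigroup m S + sigma_finite_measure m
  for m :: "'a measure" and S +
  assumes dense: "l2_dense m (Domain (semigroup_generator m S))"
    and symmetric: "l2_symmetric m (semigroup_generator m S)"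
    and sub_Markov: "sub_Markovian m S"
begin

lemma S_bounds:
  assumes "t \<ge> 0" "u \<in> L2 m" "AE x in m. 0 \<le> u x \<and> u x \<le> 1"
  shows "AE x in m. 0 \<le> S t u x \<and> S t u x \<le> 1"
  using sub_Markov assms unfolding sub_Markovian_def by blast

text \<open>The sub-Markov property concerns functions with values in [0, 1], so \<open>u\<close> is
  scaled into this range by the inverse of \<open>max C 1\<close>; the maximum makes the factor
  positive.\<close>

lemma S_nonneg:
  assumes u: "u \<in> L2 m" "AE x in m. 0 \<le> u x" "AE x in m. \<bar>u x\<bar> \<le> C" and t: "t \<ge> 0"
  shows "AE x in m. 0 \<le> S t u x"
proof -
  define c where "c = inverse (max C 1)"
  have c: "c > 0" by (simp add: c_def less_max_iff_disj)
  have "AE x in m. 0 \<le> c * u x \<and> c * u x \<le> 1"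
    using u(2,3)
  proof eventually_elim
    case (elim x)
    then have "u x \<le> max C 1" by auto
    then show ?case using elim c by (auto simp: c_def field_simps)
  qed
  from S_bounds[OF t L2_scale[OF u(1)] this] S_scale[OF t u(1), of c] show ?thesis
    by eventually_elim (use c in \<open>simp add: zero_le_mult_iff\<close>)
qed

text \<open>The case distinction keeps \<open>orbit u 0\<close> literally equal to \<open>u \<cdot> m\<close>: \<open>S 0 u\<close> agrees with u
  only almost everywhere.\<close>

definition orbit :: "('a \<Rightarrow> real) \<Rightarrow> real \<Rightarrow> 'a measure" where
  "orbit u t = density m (\<lambda>x. ennreal (if t = 0 then u x else S t u x))"

section \<open>Orbits of a bounded density as paths of measures\<close>

context
  fixes u :: "'a \<Rightarrow> real"
  assumes u: "u \<in> bounded_densities m"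
begin

lemma u_L2: "u \<in> L2 m"
  by (rule bounded_densities_L2[OF u])

lemma density_AE_eq:
  assumes "t \<ge> 0"
  shows "AE x in m. (if t = 0 then u x else S t u x) = S t u x"
  using S_zero[OF u_L2] by eventually_elim auto

lemma density_L2: "t \<ge> 0 \<Longrightarrow> (\<lambda>x. if t = 0 then u x else S t u x) \<in> L2 m"
  using u_L2 S_L2 by (cases "t = 0") auto

lemma density_nonneg:
  assumes "t \<ge> 0"
  shows "AE x in m. 0 \<le> (if t = 0 then u x else S t u x)"
proof -
  obtain C where "AE x in m. \<bar>u x\<bar> \<le> C" "AE x in m. 0 \<le> u x"
    using u by (auto simp: bounded_densities_def)
  from S_nonneg[OF u_L2 this(2,1) assms] show ?thesis
    using density_AE_eq[OF assms] by eventually_elim simp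
qed

lemma inner_density:
  assumes "t \<ge> 0" "w \<in> L2 m"
  shows "l2_inner m (\<lambda>x. if t = 0 then u x else S t u x) w = l2_inner m (S t u) w"
  by (intro l2_inner_cong_AE L2_measurable density_L2 S_L2 u_L2 assms density_AE_eq) simp

lemma integrable_orbit:
  assumes t: "t \<ge> 0" and w: "w \<in> L2 m"
  shows "integrable (orbit u t) w"
  unfolding orbit_def using integrable_mult_L2[OF density_L2[OF t] w]
  by (subst integrable_density)
     (use density_nonneg[OF t] L2_measurable[OF density_L2[OF t]] L2_measurable[OF w] in auto)

lemma integral_orbit:
  assumes t: "t \<ge> 0" and w: "w \<in> L2 m"
  shows "(\<integral>x. w x \<partial>orbit u t) = l2_inner m (S t u) w"
proof -
  have "(\<integral>x. w x \<partial>orbit u t) = l2_inner m (\<lambda>x. if t = 0 then u x else S t u x) w"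
    unfolding orbit_def l2_inner_def
    by (subst integral_density)
       (use density_nonneg[OF t] L2_measurable[OF density_L2[OF t]] L2_measurable[OF w] in auto)
  then show ?thesis using inner_density[OF t w] by simp
qed

lemma sets_orbit: "sets (orbit u t) = sets m"
  by (simp add: orbit_def)

text \<open>Finite measure of \<open>A\<close> puts its indicator into L2, so the measure becomes an
  L2 inner product, to which symmetry and continuity in time apply.\<close>

lemma emeasure_orbit:
  assumes t: "t \<ge> 0" and A: "A \<in> sets m" "emeasure m A < \<infinity>"
  shows "emeasure (orbit u t) A = ennreal (l2_inner m (S t u) (indicator A))"
proof -
  let ?v = "\<lambda>x. if t = 0 then u x else S t u x"
  have vm: "?v \<in> borel_measurable m" by (rule L2_measurable[OF density_L2[OF t]])
  have "emeasure (orbit u t) A = (\<integral>\<^sup>+x. ennreal (?v x) * indicator A x \<partial>m)"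
    unfolding orbit_def by (rule emeasure_density) (use vm A in auto)
  also have "\<dots> = (\<integral>\<^sup>+x. ennreal (?v x * indicator A x) \<partial>m)"
    by (intro nn_integral_cong) (simp add: indicator_def)
  also have "\<dots> = ennreal (l2_inner m ?v (indicator A))"
    unfolding l2_inner_def
  proof (rule nn_integral_eq_integral)
    show "integrable m (\<lambda>x. ?v x * indicator A x)"
      by (rule integrable_mult_L2[OF density_L2[OF t] indicator_L2[OF A]])
    show "AE x in m. 0 \<le> ?v x * indicator A x"
      using density_nonneg[OF t] by eventually_elim simp
  qed
  finally show ?thesis using inner_density[OF t indicator_L2[OF A]] by simp
qed

lemma inner_indicator_nonneg:
  assumes t: "t \<ge> 0" and A: "A \<in> sets m" "emeasure m A < \<infinity>"
  shows "0 \<le> l2_inner m (S t u) (indicator A)"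
  unfolding inner_density[OF t indicator_L2[OF A], symmetric] unfolding l2_inner_def
  using density_nonneg[OF t] by (intro integral_nonneg_AE) auto

lemma measure_orbit:
  assumes "t \<ge> 0" "A \<in> sets m" "emeasure m A < \<infinity>"
  shows "measure (orbit u t) A = l2_inner m (S t u) (indicator A)"
  using emeasure_orbit[OF assms] inner_indicator_nonneg[OF assms] by (simp add: measure_def)

text \<open>The indicator stands in for the constant 1: symmetry moves \<open>S t\<close> onto it,
  the sub-Markov property bounds the image by 1, and the integral of \<open>u\<close>
  remains.\<close>

lemma inner_indicator_le_1:
  assumes t: "t \<ge> 0" and A: "A \<in> sets m" "emeasure m A < \<infinity>"
  shows "l2_inner m (S t u) (indicator A) \<le> 1"
proof -
  have iL: "indicator A \<in> L2 m" by (rule indicator_L2[OF A])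
  have int: "integrable m u" and nn: "AE x in m. 0 \<le> u x" and int1: "(\<integral>x. u x \<partial>m) = 1"
    using u by (auto simp: bounded_densities_def)
  have "AE x in m. 0 \<le> (indicator A x :: real) \<and> (indicator A x :: real) \<le> 1"
    by (simp add: indicator_def)
  from S_bounds[OF t iL this] nn have "AE x in m. u x * S t (indicator A) x \<le> u x"
    by eventually_elim (simp add: mult_left_le)
  then have "l2_inner m u (S t (indicator A)) \<le> (\<integral>x. u x \<partial>m)"
    unfolding l2_inner_def
    by (intro integral_mono_AE integrable_mult_L2 u_L2 S_L2 t iL int)
  then show ?thesis
    using S_symmetric[OF dense symmetric t u_L2 iL] int1 by simp
qed

lemma emeasure_orbit_le_1:
  assumes t: "t \<ge> 0"
  shows "emeasure (orbit u t) (space m) \<le> 1"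
proof -
  obtain A :: "nat \<Rightarrow> 'a set" where A: "range A \<subseteq> sets m" "(\<Union>i. A i) = space m"
      "\<And>i. emeasure m (A i) \<noteq> \<infinity>" "incseq A" using sigma_finite_incseq by metis
  have "(SUP n. emeasure (orbit u t) (A n)) = emeasure (orbit u t) (\<Union>i. A i)"
    using A by (intro SUP_emeasure_incseq) (auto simp: sets_orbit)
  moreover have "emeasure (orbit u t) (A n) \<le> 1" for n
    using A(1) A(3)[of n] emeasure_orbit[OF t, of "A n"] inner_indicator_le_1[OF t, of "A n"]
    by (auto simp: less_top ennreal_le_1)
  ultimately show ?thesis using A(2) by (metis SUP_least)
qed

text \<open>On sets of finite measure the function is continuous in time. A general set is exhausted
  by such sets, and the mass bound justifies continuity from below for the real-valued
  measure.\<close>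

lemma measure_orbit_measurable:
  assumes B: "B \<in> sets m"
  shows "(\<lambda>t. measure (orbit u t) B) \<in> borel_measurable (lebesgue_on {0..})"
proof -
  obtain A :: "nat \<Rightarrow> 'a set" where A: "range A \<subseteq> sets m" "(\<Union>i. A i) = space m"
      "\<And>i. emeasure m (A i) \<noteq> \<infinity>" "incseq A" using sigma_finite_incseq by metis
  have AB: "B \<inter> A n \<in> sets m" "emeasure m (B \<inter> A n) < \<infinity>" for n
    using A(1) B emeasure_mono[of "B \<inter> A n" "A n" m] A(3)[of n]
    by (auto simp: less_top top_unique)
  show ?thesis
  proof (rule borel_measurable_LIMSEQ_real)
    fix t assume "t \<in> space (lebesgue_on {0::real..})"
    then have t: "t \<ge> 0" by simp
    have "(\<lambda>n. measure (orbit u t) (B \<inter> A n)) \<longlonglongrightarrow> measure (orbit u t) (\<Union>n. B \<inter> A n)"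
    proof (rule Lim_measure_incseq)
      show "range (\<lambda>n. B \<inter> A n) \<subseteq> sets (orbit u t)" using AB by (auto simp: sets_orbit)
      show "incseq (\<lambda>n. B \<inter> A n)" using A(4) by (auto simp: incseq_def)
      have "emeasure (orbit u t) (\<Union>n. B \<inter> A n) \<le> emeasure (orbit u t) (space m)"
        using B by (intro emeasure_mono) (auto simp: sets_orbit dest: sets.sets_into_space)
      also have "\<dots> \<le> 1" by (rule emeasure_orbit_le_1[OF t])
      finally show "emeasure (orbit u t) (\<Union>n. B \<inter> A n) \<noteq> \<infinity>" by (auto simp: top_unique)
    qed
    moreover have "(\<Union>n. B \<inter> A n) = B"
      using A(2) sets.sets_into_space[OF B] by auto
    ultimately show "(\<lambda>n. l2_inner m (S t u) (indicator (B \<inter> A n))) \<longlonglongrightarrow> measure (orbit u t) B"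
      using measure_orbit[OF t AB] by simp
  next
    fix n
    show "(\<lambda>t. l2_inner m (S t u) (indicator (B \<inter> A n))) \<in> borel_measurable (lebesgue_on {0..})"
      by (intro continuous_imp_measurable_on_sets_lebesgue inner_S_continuous u_L2 indicator_L2 AB)
         auto
  qed
qed

lemma ac_path_from_orbit: "ac_path_from m u (orbit u)"
proof -
  have "absolutely_continuous m (orbit u t)" if "t \<ge> 0" for t
    unfolding orbit_def using L2_measurable[OF density_L2[OF that]]
    by (intro absolutely_continuousI_density) auto
  moreover have "orbit u 0 = density m (\<lambda>x. ennreal (u x))" by (simp add: orbit_def)
  ultimately show ?thesis
    using emeasure_orbit_le_1 measure_orbit_measurable
    by (simp add: ac_path_from_def SP_def sets_orbit)
qed

text \<open>The density \<open>u\<close> need not belong to the domain of the generator, so symmetry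
  shifts the semigroup, and with it the differentiation, onto \<open>\<phi>\<close>.\<close>

lemma orbit_derivative:
  assumes "(\<phi>, \<psi>) \<in> L" "t \<ge> 0"
  shows "((\<lambda>t. l2_inner m (S t u) \<phi>) has_real_derivative l2_inner m (S t u) \<psi>)
    (at t within {0..})"
proof -
  have L2: "\<phi> \<in> L2 m" "\<psi> \<in> L2 m" using assms by (auto simp: semigroup_generator_def)
  have sym: "l2_inner m (S s u) w = l2_inner m (S s w) u" if "s \<ge> 0" "w \<in> L2 m" for s w
    using S_symmetric[OF dense symmetric that(1) u_L2 that(2)] l2.commute[OF u_L2 S_L2[OF that]]
    by simp
  have "((\<lambda>t. l2_inner m (S t \<phi>) u) has_real_derivative l2_inner m (S t u) \<psi>) (at t within {0..})"
    using inner_S_derivative[OF assms(1) u_L2 assms(2)] sym[OF assms(2) L2(2)] by simp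
  then show ?thesis
    by (rule has_field_derivative_transform_within[where d = 1]) (use assms(2) sym L2 in auto)
qed

lemma orbit_solves_a:
  assumes L0: "L0 \<subseteq> L"
  shows "equation_a L0 (orbit u)"
  unfolding equation_a_def
proof (intro allI impI ballI, clarify)
  fix t :: real and \<phi> \<psi> assume t: "t \<ge> 0" and "(\<phi>, \<psi>) \<in> L0"
  then have gen: "(\<phi>, \<psi>) \<in> L" using L0 by blast
  then have L2: "\<phi> \<in> L2 m" "\<psi> \<in> L2 m" by (auto simp: semigroup_generator_def)
  define g where "g s = l2_inner m (S s u) \<psi>" for s
  have g: "(\<integral>x. \<psi> x \<partial>orbit u s) = g s" if "s \<ge> 0" for s
    using integral_orbit[OF that L2(2)] by (simp add: g_def)
  have cont: "continuous_on {0..t} g"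
    unfolding g_def by (rule continuous_on_subset[OF inner_S_continuous[OF u_L2 L2(2)]]) auto
  \<comment> \<open>Continuity makes \<open>g\<close> Lebesgue integrable, so that the gauge
    integral in the fundamental theorem below agrees with the Lebesgue integral of the
    equation.\<close>
  have int: "integrable (lebesgue_on {0..t}) g"
    by (rule continuous_imp_integrable_real[OF cont])
  have "(g has_integral (l2_inner m (S t u) \<phi> - l2_inner m (S 0 u) \<phi>)) {0..t}"
  proof (rule fundamental_theorem_of_calculus[OF t])
    fix s assume s: "s \<in> {0..t}"
    have "((\<lambda>t. l2_inner m (S t u) \<phi>) has_real_derivative g s) (at s within {0..t})"
      unfolding g_def
      by (rule has_field_derivative_subset[OF orbit_derivative[OF gen]]) (use s in auto)
    then show "((\<lambda>t. l2_inner m (S t u) \<phi>) has_vector_derivative g s) (at s within {0..t})"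
      by (simp add: has_real_derivative_iff_has_vector_derivative)
  qed
  then have FTC: "integral {0..t} g = l2_inner m (S t u) \<phi> - l2_inner m (S 0 u) \<phi>"
    by (rule integral_unique)
  have eq: "(\<integral>s. (\<integral>x. \<psi> x \<partial>orbit u s) \<partial>lebesgue_on {0..t}) = integral\<^sup>L (lebesgue_on {0..t}) g"
    by (rule Bochner_Integration.integral_cong) (auto simp: g)
  show "integrable (orbit u t) \<phi> \<and> integrable (orbit u 0) \<phi> \<and>
      (AE s in lebesgue_on {0..t}. integrable (orbit u s) \<psi>) \<and>
      integrable (lebesgue_on {0..t}) (\<lambda>s. \<integral>x. \<psi> x \<partial>orbit u s) \<and>
      (\<integral>x. \<phi> x \<partial>orbit u t) =
        (\<integral>x. \<phi> x \<partial>orbit u 0) + (\<integral>s. (\<integral>x. \<psi> x \<partial>orbit u s) \<partial>lebesgue_on {0..t})"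
  proof (intro conjI)
    show "AE s in lebesgue_on {0..t}. integrable (orbit u s) \<psi>"
      by (rule AE_I2) (simp add: integrable_orbit L2)
    show "integrable (lebesgue_on {0..t}) (\<lambda>s. \<integral>x. \<psi> x \<partial>orbit u s)"
      using int by (subst Bochner_Integration.integrable_cong[OF refl, where g = g]) (auto simp: g)
    show "(\<integral>x. \<phi> x \<partial>orbit u t) =
        (\<integral>x. \<phi> x \<partial>orbit u 0) + (\<integral>s. (\<integral>x. \<psi> x \<partial>orbit u s) \<partial>lebesgue_on {0..t})"
      unfolding eq using lebesgue_integral_eq_integral[OF int] FTC integral_orbit[OF _ L2(1)] t
      by simp
  qed (use integrable_orbit L2 t in auto)
qed

lemma orbit_solves_b:
  assumes L0: "L0 \<subseteq> L"
  shows "equation_b L0 (orbit u)"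
  unfolding equation_b_def
proof (intro allI impI ballI, clarify)
  fix T :: real and \<phi> \<psi> and f f' :: "real \<Rightarrow> real"
  assume T: "T > 0" and "(\<phi>, \<psi>) \<in> L0"
    and f: "\<forall>s\<in>{0..T}. (f has_real_derivative f' s) (at s within {0..T})"
    and f': "continuous_on {0..T} f'" and fT: "f T = 0"
  then have gen: "(\<phi>, \<psi>) \<in> L" using L0 by blast
  then have L2: "\<phi> \<in> L2 m" "\<psi> \<in> L2 m" by (auto simp: semigroup_generator_def)
  have mix: "(\<lambda>x. f' s * \<phi> x + f s * \<psi> x) \<in> L2 m" for s
    by (intro L2_add L2_scale L2)
  define p where "p s = l2_inner m (S s u) \<phi>" for s
  define g where "g s = f' s * p s + f s * l2_inner m (S s u) \<psi>" for s
  have g: "(\<integral>x. f' s * \<phi> x + f s * \<psi> x \<partial>orbit u s) = g s" if "s \<ge> 0" for s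
  proof -
    have "(\<integral>x. f' s * \<phi> x + f s * \<psi> x \<partial>orbit u s)
        = l2_inner m (S s u) (\<lambda>x. f' s * \<phi> x + f s * \<psi> x)"
      by (rule integral_orbit[OF that mix])
    also have "\<dots> = l2_inner m (S s u) (\<lambda>x. f' s * \<phi> x) + l2_inner m (S s u) (\<lambda>x. f s * \<psi> x)"
      by (intro l2.add_right L2_scale L2 S_L2 u_L2 that)
    also have "\<dots> = g s"
      using L2 S_L2[OF that u_L2] by (simp add: l2.scale_right g_def p_def)
    finally show ?thesis .
  qed
  have contf: "continuous_on {0..T} f"
    using f by (auto simp: continuous_on_eq_continuous_within intro: DERIV_continuous)
  have cont: "continuous_on {0..T} g"
    unfolding g_def p_def
    by (intro continuous_intros contf f'
        continuous_on_subset[OF inner_S_continuous[OF u_L2 L2(1)]]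
        continuous_on_subset[OF inner_S_continuous[OF u_L2 L2(2)]]) auto
  have int: "integrable (lebesgue_on {0..T}) g"
    by (rule continuous_imp_integrable_real[OF cont])
  \<comment> \<open>By the product rule \<open>g\<close> is the derivative of
    \<open>f s * p s\<close>; the boundary term at \<open>T\<close> vanishes through
    \<open>f T = 0\<close>.\<close>
  have "(g has_integral (f T * p T - f 0 * p 0)) {0..T}"
  proof (rule fundamental_theorem_of_calculus)
    fix s assume s: "s \<in> {0..T}"
    have "(p has_real_derivative l2_inner m (S s u) \<psi>) (at s within {0..T})"
      unfolding p_def
      by (rule has_field_derivative_subset[OF orbit_derivative[OF gen]]) (use s in auto)
    then have "((\<lambda>s. f s * p s) has_real_derivative g s) (at s within {0..T})"
      unfolding g_def using f s by (auto intro!: derivative_eq_intros)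
    then show "((\<lambda>s. f s * p s) has_vector_derivative g s) (at s within {0..T})"
      by (simp add: has_real_derivative_iff_has_vector_derivative)
  qed (use T in simp)
  then have FTC: "integral {0..T} g = - f 0 * p 0"
    using fT by (simp add: integral_unique)
  have eq: "(\<integral>s. (\<integral>x. f' s * \<phi> x + f s * \<psi> x \<partial>orbit u s) \<partial>lebesgue_on {0..T})
      = integral\<^sup>L (lebesgue_on {0..T}) g"
    by (rule Bochner_Integration.integral_cong) (auto simp: g)
  show "integrable (orbit u 0) \<phi> \<and>
      (AE s in lebesgue_on {0..T}. integrable (orbit u s) (\<lambda>x. f' s * \<phi> x + f s * \<psi> x)) \<and>
      integrable (lebesgue_on {0..T}) (\<lambda>s. \<integral>x. f' s * \<phi> x + f s * \<psi> x \<partial>orbit u s) \<and>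
      (\<integral>s. (\<integral>x. f' s * \<phi> x + f s * \<psi> x \<partial>orbit u s) \<partial>lebesgue_on {0..T})
        = - f 0 * (\<integral>x. \<phi> x \<partial>orbit u 0)"
  proof (intro conjI)
    show "integrable (orbit u 0) \<phi>" by (intro integrable_orbit L2) simp
    show "AE s in lebesgue_on {0..T}. integrable (orbit u s) (\<lambda>x. f' s * \<phi> x + f s * \<psi> x)"
      by (rule AE_I2) (simp add: integrable_orbit mix)
    show "integrable (lebesgue_on {0..T}) (\<lambda>s. \<integral>x. f' s * \<phi> x + f s * \<psi> x \<partial>orbit u s)"
      using int by (subst Bochner_Integration.integrable_cong[OF refl, where g = g]) (auto simp: g)
    show "(\<integral>s. (\<integral>x. f' s * \<phi> x + f s * \<psi> x \<partial>orbit u s) \<partial>lebesgue_on {0..T})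
        = - f 0 * (\<integral>x. \<phi> x \<partial>orbit u 0)"
      unfolding eq using lebesgue_integral_eq_integral[OF int] FTC integral_orbit[OF _ L2(1), of 0]
      by (simp add: p_def)
  qed
qed

end

end

section \<open>Uniqueness\<close>

text \<open>The coincidence set is closed and has full measure in the open half-line, so it contains
  that half-line.\<close>

lemma continuous_AE_eq_imp_eq:
  fixes f g :: "real \<Rightarrow> real"
  assumes "continuous_on {0..} f" "continuous_on {0..} g"
    and ae: "AE t in lebesgue_on {0..}. f t = g t" and t: "t > 0"
  shows "f t = g t"
proof -
  \<comment> \<open>Composition with \<open>max 0\<close> extends the difference continuously to the
    whole line, so its zero set is closed in the reals.\<close>
  define h where "h s = f (max 0 s) - g (max 0 s)" for s
  have "continuous_on UNIV h"
    unfolding h_def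
    by (intro continuous_on_diff continuous_on_compose2[OF assms(1)]
        continuous_on_compose2[OF assms(2)] continuous_intros) auto
  then have "closed {s. h s = 0}"
    by (intro closed_Collect_eq) auto
  moreover have "AE s \<in> {0<..} in lebesgue. s \<in> {s. h s = 0}"
  proof -
    have "AE s in lebesgue. s \<in> {0..} \<longrightarrow> f s = g s"
      using ae by (subst (asm) AE_restrict_space_iff) auto
    then show ?thesis by eventually_elim (auto simp: h_def max_def)
  qed
  ultimately have "t \<in> {s. h s = 0}"
    using t mem_closed_if_AE_lebesgue_open[of "{0<..}" "{s. h s = 0}" t] by simp
  then show ?thesis using t by (simp add: h_def max_def)
qed

lemma semigroups_eq:
  assumes "symmetric_sub_Markovian_semigroup m S" "symmetric_sub_Markovian_semigroup m S'"
    and L0: "L0 \<subseteq> semigroup_generator m S" "L0 \<subseteq> semigroup_generator m S'"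
    and solv: "(\<forall>u\<in>bounded_densities m. uniquely_solvable_a m L0 u) \<or>
         (\<forall>u\<in>bounded_densities m. uniquely_solvable_b m L0 u)"
    and t: "t > 0" and w: "w \<in> L2 m"
  shows "AE x in m. S t w x = S' t w x"
proof -
  interpret S: symmetric_sub_Markovian_semigroup m S by fact
  interpret S': symmetric_sub_Markovian_semigroup m S' by fact
  have t0: "t \<ge> 0" using t by simp
  have eq: "AE x in m. S t u x = S' t u x" if u: "u \<in> bounded_densities m" for u
  proof (rule S.AE_eq_if_inner_indicator_eq)
    have uL: "u \<in> L2 m" by (rule bounded_densities_L2[OF u])
    show "S t u \<in> L2 m" "S' t u \<in> L2 m" using S.S_L2 S'.S_L2 t0 uL by auto
    fix A assume A: "A \<in> sets m" "emeasure m A < \<infinity>"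
    note meas = S.measure_orbit[OF u _ A] S'.measure_orbit[OF u _ A]
    note cont = S.inner_S_continuous[OF uL indicator_L2[OF A]]
      S'.inner_S_continuous[OF uL indicator_L2[OF A]]
    from solv show "l2_inner m (S t u) (indicator A) = l2_inner m (S' t u) (indicator A)"
    proof
      assume "\<forall>u\<in>bounded_densities m. uniquely_solvable_a m L0 u"
      then obtain \<mu> where \<mu>: "\<And>\<nu>. ac_path_from m u \<nu> \<Longrightarrow> equation_a L0 \<nu> \<Longrightarrow> \<forall>t\<ge>0. \<nu> t = \<mu> t"
        using u unfolding uniquely_solvable_a_def by blast
      have "S.orbit u t = S'.orbit u t"
        using \<mu>[OF S.ac_path_from_orbit[OF u] S.orbit_solves_a[OF u L0(1)]]
          \<mu>[OF S'.ac_path_from_orbit[OF u] S'.orbit_solves_a[OF u L0(2)]] t0 by simp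
      then show ?thesis using meas[OF t0] by simp
    next
      assume "\<forall>u\<in>bounded_densities m. uniquely_solvable_b m L0 u"
      then obtain \<mu> where \<mu>: "\<And>\<nu>. ac_path_from m u \<nu> \<Longrightarrow> equation_b L0 \<nu> \<Longrightarrow>
          AE t in lebesgue_on {0..}. \<nu> t = \<mu> t"
        using u unfolding uniquely_solvable_b_def by blast
      \<comment> \<open>Equation (b) identifies the two orbits only at almost every time; weak
        continuity then yields equality at the given \<open>t\<close>.\<close>
      have "AE t in lebesgue_on {0..}.
          l2_inner m (S t u) (indicator A) = l2_inner m (S' t u) (indicator A)"
        using \<mu>[OF S.ac_path_from_orbit[OF u] S.orbit_solves_b[OF u L0(1)]]
          \<mu>[OF S'.ac_path_from_orbit[OF u] S'.orbit_solves_b[OF u L0(2)]] AE_space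
      proof eventually_elim
        case (elim t)
        then show ?case using meas[of t] by simp
      qed
      from continuous_AE_eq_imp_eq[OF cont this t] show ?thesis .
    qed
  qed
  show ?thesis
  proof (rule S.AE_eq_if_inner_indicator_eq)
    show L2: "S t w \<in> L2 m" "S' t w \<in> L2 m" using S.S_L2 S'.S_L2 t0 w by auto
    fix A assume A: "A \<in> sets m" "emeasure m A < \<infinity>"
    note iL = indicator_L2[OF A]
    show "l2_inner m (S t w) (indicator A) = l2_inner m (S' t w) (indicator A)"
    proof (cases "measure m A = 0")
      \<comment> \<open>A null set admits no normalized indicator, but its indicator has norm 0 and
        both inner products vanish.\<close>
      case True
      then have "l2_norm m (indicator A) = 0"
        using A by (simp add: l2_norm_def l2_inner_def flip: indicator_inter_arith)
      then show ?thesis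
        using l2.Cauchy_Schwarz[OF L2(1) iL] l2.Cauchy_Schwarz[OF L2(2) iL] by simp
    next
      case False
      \<comment> \<open>Symmetry moves the semigroup from the arbitrary \<open>w\<close> onto this
        bounded density, where the two semigroups are already known to agree, and back
        again.\<close>
      let ?u = "\<lambda>x. indicator A x / measure m A"
      have u: "?u \<in> bounded_densities m"
        by (rule normalized_indicator_bounded_density[OF A False])
      have uL: "?u \<in> L2 m" by (rule bounded_densities_L2[OF u])
      have "l2_inner m ?u (S t w) = l2_inner m (S t ?u) w"
        using S.S_symmetric[OF S.dense S.symmetric t0 uL w] by simp
      also have "\<dots> = l2_inner m (S' t ?u) w"
        by (intro l2_inner_cong_AE L2_measurable S.S_L2 S'.S_L2 t0 uL w eq[OF u]) simp
      also have "\<dots> = l2_inner m ?u (S' t w)"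
        using S'.S_symmetric[OF S'.dense S'.symmetric t0 uL w] by simp
      finally have "l2_inner m (indicator A) (S t w) = l2_inner m (indicator A) (S' t w)"
        using l2.divide_left[OF iL L2(1)] l2.divide_left[OF iL L2(2)] False by simp
      then show ?thesis using l2.commute[OF iL L2(1)] l2.commute[OF iL L2(2)] by simp
    qed
  qed
qed

text \<open>The defining limit at 0 from the right only sees strictly positive times.\<close>

lemma semigroup_generator_cong:
  assumes "strongly_continuous_semigroup m S" "strongly_continuous_semigroup m S'"
    and eq: "\<And>t w. t > 0 \<Longrightarrow> w \<in> L2 m \<Longrightarrow> AE x in m. S t w x = S' t w x"
  shows "semigroup_generator m S = semigroup_generator m S'"
proof -
  interpret S: l2_semigroup m S by standard fact
  interpret S': l2_semigroup m S' by standard fact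
  have "((\<lambda>t. l2_norm m (\<lambda>x. (S t u x - u x) / t - v x)) \<longlongrightarrow> 0) (at_right 0) \<longleftrightarrow>
      ((\<lambda>t. l2_norm m (\<lambda>x. (S' t u x - u x) / t - v x)) \<longlongrightarrow> 0) (at_right 0)"
    if u: "u \<in> L2 m" and v: "v \<in> L2 m" for u v
  proof (rule tendsto_cong)
    show "\<forall>\<^sub>F t in at_right 0. l2_norm m (\<lambda>x. (S t u x - u x) / t - v x)
        = l2_norm m (\<lambda>x. (S' t u x - u x) / t - v x)"
      using eventually_at_right_less[of "0::real"]
    proof eventually_elim
      case (elim t)
      then have t: "t \<ge> 0" by simp
      show ?case
      proof (rule l2_norm_cong_AE)
        show "AE x in m. (S t u x - u x) / t - v x = (S' t u x - u x) / t - v x"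
          using eq[OF elim u] by eventually_elim simp
      qed (intro L2_measurable l2.diff_mem l2.divide_mem S.S_L2 S'.S_L2 u v t)+
    qed
  qed
  then show ?thesis by (auto simp: semigroup_generator_def)
qed

theorem theorem2p4:
  fixes m :: "'a measure" and L0 :: "'a l2_graph"
  assumes "sigma_finite_measure m"
    and "l2_operator m L0"
    and "l2_dense m (Domain L0)"
    and "l2_symmetric m L0"
    and "upper_bounded m L0"
    and "(\<forall>u\<in>bounded_densities m. uniquely_solvable_a m L0 u) \<or>
         (\<forall>u\<in>bounded_densities m. uniquely_solvable_b m L0 u)"
  shows "(\<forall>L\<in>M_sym_M m L0. \<forall>L'\<in>M_sym_M m L0. L = L') \<and>
         (generates_sub_Markovian m (friedrichs_extension m L0) \<longrightarrow>
            M_sym_M m L0 = {friedrichs_extension m L0})"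
proof -
  have semigroup: "\<exists>S. symmetric_sub_Markovian_semigroup m S \<and> L = semigroup_generator m S"
    if L: "L \<in> M_sym_M m L0" for L
  proof -
    from L obtain S where S: "strongly_continuous_semigroup m S" "L = semigroup_generator m S"
        "sub_Markovian m S" "L0 \<subseteq> L" "l2_symmetric m L"
      by (auto simp: M_sym_M_def generates_sub_Markovian_def generates_def)
    \<comment> \<open>Density of the domain of \<open>L\<close> is inherited from the smaller domain
      of \<open>L0\<close>.\<close>
    have "Domain L \<subseteq> L2 m" by (auto simp: S(2) semigroup_generator_def)
    then have "l2_dense m (Domain L)"
      using assms(3) Domain_mono[OF S(4)] unfolding l2_dense_def by (meson in_mono)
    then have "symmetric_sub_Markovian_semigroup m S"
      using S assms(1)
      by (simp add: symmetric_sub_Markovian_semigroup_def l2_semigroup_def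
          symmetric_sub_Markovian_semigroup_axioms_def)
    then show ?thesis using S(2) by blast
  qed
  have unique: "\<forall>L\<in>M_sym_M m L0. \<forall>L'\<in>M_sym_M m L0. L = L'"
  proof (intro ballI)
    fix L L' assume LL': "L \<in> M_sym_M m L0" "L' \<in> M_sym_M m L0"
    then obtain S S' where S: "symmetric_sub_Markovian_semigroup m S" "L = semigroup_generator m S"
        "symmetric_sub_Markovian_semigroup m S'" "L' = semigroup_generator m S'"
      using semigroup by meson
    have "L0 \<subseteq> semigroup_generator m S" "L0 \<subseteq> semigroup_generator m S'"
      using LL' S by (auto simp: M_sym_M_def)
    from semigroups_eq[OF S(1,3) this assms(6)] show "L = L'"
      unfolding S(2,4)
      by (intro semigroup_generator_cong)
         (use S in \<open>auto simp: symmetric_sub_Markovian_semigroup_def l2_semigroup_def\<close>)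
  qed
  interpret upper_bounded_symmetric m L0
    using assms by unfold_locales
  have "friedrichs_extension m L0 \<in> M_sym_M m L0"
    if "generates_sub_Markovian m (friedrichs_extension m L0)"
    using that friedrichs_operator friedrichs_extends friedrichs_symmetric
    by (auto simp: M_sym_M_def is_generator_def generates_sub_Markovian_def)
  with unique show ?thesis by blast
qed

end
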